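(* Suppose that some full Gibbs sampler for $\pi$ has a spectral gap, i.e. at least one of the operators $P_{E_{\rho(1)}}\cdots P_{E_{\rho(K)}}$ ($\rho$ a permutation of $[K]$) or $\sum_{i=1}^K w_iP_{E_i}$ ($w_i\in(0,1)$, $\sum_{i=1}^K w_i=1$) on $L^2(\pi)$ has a spectral gap. Then every cycle and every mixture of Gibbs steps on $L^2(\pi)$ has a spectral gap, and (when $K\ge 3$) for every proper subset $I\subset[K]$ with at least two elements, every cycle and every mixture of collapsed Gibbs steps on $L^2(\pi_I)$ has a spectral gap.
   Context: Setting. Let $K\ge 2$ be an integer and write $[n]=\{1,\dots,n\}$. For $k\in[K]$ let $\mathcal X_k$ be a complete separable metric space with its Borel $\sigma$-algebra, $\mathcal X=\mathcal X_1\times\cdots\times\mathcal X_K$, and let $\pi$ be a Borel probability measure on $\mathcal X$. $L^2(\pi)$ is the complex Hilbert space of square-integrable measurable functions $f:\mathcal X\to\mathbb C$ (identified when equal $\pi$-a.e.) with $\langle f,g\rangle=\int f\overline g\,d\pi$. For $I\subset[K]$, $x_I$ and $x_{-I}$ are the coordinates of $x$ with indices in $I$, respectively in $[K]\setminus I$; $\mathcal X_I$, $\mathcal X_{-I}$ are the corresponding product spaces. $\pi(\cdot\mid x_{-I})$ is the (regular) conditional distribution of $X_I$ given $X_{-I}=x_{-I}$ when $X\sim\pi$. $\Pi f$ is the constant function $\int f\,d\pi$. $E_i$ is the closed subspace of functions in $L^2(\pi)$ that are constant with respect to the $i$th coordinate. For nonempty $I\subseteq[K]$, $\bigcap_{i\in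 I}E_i$ is the closed subspace of functions constant with respect to all coordinates in $I$, i.e. of classes having a representative depending only on $x_{-I}$ (the constants if $I=[K]$). For a nonempty proper subset $I\subset[K]$ and $F=\bigcap_{i\in I}E_i$, the Gibbs step $P_F$ is the orthogonal projection of $L^2(\pi)$ onto $F$, given by $(P_Ff)(x)=\int_{\mathcal X_I}f(x_I',x_{-I})\,\pi(dx_I'\mid x_{-I})$. Cycles and mixtures. Let $I_1,\dots,I_g$ be nonempty proper subsets of $[K]$ with $\bigcup_{d=1}^gI_d=[K]$ (hence $g\ge 2$; the sets may overlap) and $F_d=\bigcap_{i\in I_d}E_i$. A cycle of Gibbs steps is an operator $P_{F_1}\cdots P_{F_g}$; a mixture of Gibbs steps is an operator $\sum_{d=1}^gw_dP_{F_d}$ with $w_d\in(0,1)$, $\sum_dw_d=1$. Collapsed versions. For a proper subset $I\subset[K]$ with $|I|\ge 2$, $\pi_I$ is the marginal distribution of $\pi$ on $\mathcal X_I$, and $L^2(\pi_I)$ is the complex Hilbert space of square-integrable measurable functions $f:\mathcal X_I\to\mathbb C$ (identified when equal $\pi_I$-a.e.). For $j\in I$, $E_j^{(I)}$ is the closed subspace of functions in $L^2(\pi_I)$ that are constant with respect to the coordinate with index $j$. For a nonempty proper subset $J\subset I$, $\bigcap_{j\in J}E_j^{(I)}$ is the closed subspace of functions in $L^2(\pi_I)$ constant with respect to all coordinates in $J$, i.e. of classes having a representative depending only on the coordinates with indices in $I\setminus J$, and the collapsed Gibbs step corresponding to $J$ is the orthogonal projection of $L^2(\pi_I)$ onto $\bigcap_{j\in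 J}E_j^{(I)}$. Let $J_1,\dots,J_g$ be nonempty proper subsets of $I$ with $\bigcup_{d=1}^gJ_d=I$ (hence $g\ge 2$; the sets may overlap) and $F_d^{(I)}=\bigcap_{j\in J_d}E_j^{(I)}$. A cycle of collapsed Gibbs steps is an operator $P_{F_1^{(I)}}\cdots P_{F_g^{(I)}}$ on $L^2(\pi_I)$; a mixture of collapsed Gibbs steps is an operator $\sum_{d=1}^gw_dP_{F_d^{(I)}}$ on $L^2(\pi_I)$ with $w_d\in(0,1)$, $\sum_dw_d=1$. $\Pi_I f$ is the constant function $\int f\,d\pi_I$. Spectral gap. With $r(T)$ the spectral radius of a bounded operator $T$, a cycle or mixture $Q$ of Gibbs steps on $L^2(\pi)$ (this includes the full Gibbs samplers) has a spectral gap if $r(Q-\Pi)<1$, and a cycle or mixture $Q$ of collapsed Gibbs steps on $L^2(\pi_I)$ has a spectral gap if $r(Q-\Pi_I)<1$. *)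

theory Defs
  imports "HOL-Probability.Probability" "HOL-Combinatorics.Permutations"
begin

text \<open>
  The complex Hilbert space \<open>L\<^sup>2(M)\<close>: its elements are the classes of square-integrable measurable
  functions modulo equality almost everywhere.  The linear operations and the inner product are
  computed on representatives; the choice of representative only changes values on a null set.
\<close>

definition square_integrable :: "'b measure \<Rightarrow> ('b \<Rightarrow> complex) set" where
  "square_integrable M =
     {f. f \<in> borel_measurable M \<and> integrable M (\<lambda>x. (cmod (f x))\<^sup>2)}"

definition L2_class :: "'b measure \<Rightarrow> ('b \<Rightarrow> complex) \<Rightarrow> ('b \<Rightarrow> complex) set" where
  "L2_class M f = {g \<in> square_integrable M. AE x in M. g x = f x}"

definition L2 :: "'b measure \<Rightarrow> ('b \<Rightarrow> complex) set set" where
  "L2 M = L2_class M ` square_integrable M"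

definition L2_rep :: "('b \<Rightarrow> complex) set \<Rightarrow> 'b \<Rightarrow> complex" where
  "L2_rep u = (SOME f. f \<in> u)"

definition L2_add ::
  "'b measure \<Rightarrow> ('b \<Rightarrow> complex) set \<Rightarrow> ('b \<Rightarrow> complex) set \<Rightarrow> ('b \<Rightarrow> complex) set" where
  "L2_add M u v = L2_class M (\<lambda>x. L2_rep u x + L2_rep v x)"

definition L2_diff ::
  "'b measure \<Rightarrow> ('b \<Rightarrow> complex) set \<Rightarrow> ('b \<Rightarrow> complex) set \<Rightarrow> ('b \<Rightarrow> complex) set" where
  "L2_diff M u v = L2_class M (\<lambda>x. L2_rep u x - L2_rep v x)"

definition L2_scale ::
  "'b measure \<Rightarrow> complex \<Rightarrow> ('b \<Rightarrow> complex) set \<Rightarrow> ('b \<Rightarrow> complex) set" where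
  "L2_scale M c u = L2_class M (\<lambda>x. c * L2_rep u x)"

definition L2_inner ::
  "'b measure \<Rightarrow> ('b \<Rightarrow> complex) set \<Rightarrow> ('b \<Rightarrow> complex) set \<Rightarrow> complex" where
  "L2_inner M u v = (\<integral>x. L2_rep u x * cnj (L2_rep v x) \<partial>M)"

definition L2_norm :: "'b measure \<Rightarrow> ('b \<Rightarrow> complex) set \<Rightarrow> real" where
  "L2_norm M u = sqrt (Re (L2_inner M u u))"

type_synonym 'b L2_op = "('b \<Rightarrow> complex) set \<Rightarrow> ('b \<Rightarrow> complex) set"

definition L2_bounded_op :: "'b measure \<Rightarrow> 'b L2_op \<Rightarrow> bool" where
  "L2_bounded_op M T \<longleftrightarrow>
     (\<forall>u\<in>L2 M. T u \<in> L2 M) \<and>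
     (\<forall>u\<in>L2 M. \<forall>v\<in>L2 M. T (L2_add M u v) = L2_add M (T u) (T v)) \<and>
     (\<forall>c. \<forall>u\<in>L2 M. T (L2_scale M c u) = L2_scale M c (T u)) \<and>
     (\<exists>B. \<forall>u\<in>L2 M. L2_norm M (T u) \<le> B * L2_norm M u)"

text \<open>
  \<open>\<lambda>\<close> lies in the spectrum of \<open>T\<close> iff \<open>\<lambda> - T\<close> has no two-sided inverse among the bounded operators.
  The supremum defining the spectral radius is taken in \<^typ>\<open>ennreal\<close>, so that it is
  meaningful without knowing beforehand that the spectrum is nonempty and bounded.
\<close>

definition L2_spectrum :: "'b measure \<Rightarrow> 'b L2_op \<Rightarrow> complex set" where
  "L2_spectrum M T =
     {l. \<not> (\<exists>S. L2_bounded_op M S \<and>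
            (\<forall>u\<in>L2 M. S (L2_diff M (L2_scale M l u) (T u)) = u \<and>
                      L2_diff M (L2_scale M l (S u)) (T (S u)) = u))}"

definition L2_spectral_radius :: "'b measure \<Rightarrow> 'b L2_op \<Rightarrow> ennreal" where
  "L2_spectral_radius M T = (SUP l\<in>L2_spectrum M T. ennreal (cmod l))"

definition L2_proj :: "'b measure \<Rightarrow> ('b \<Rightarrow> complex) set set \<Rightarrow> 'b L2_op" where
  "L2_proj M F u = (THE v. v \<in> F \<and> (\<forall>w\<in>F. L2_inner M (L2_diff M u v) w = 0))"

definition mean_op :: "'b measure \<Rightarrow> 'b L2_op" where
  "mean_op M u = L2_class M (\<lambda>_. \<integral>x. L2_rep u x \<partial>M)"

definition has_spectral_gap :: "'b measure \<Rightarrow> 'b L2_op \<Rightarrow> bool" where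
  "has_spectral_gap M Q \<longleftrightarrow> L2_spectral_radius M (\<lambda>u. L2_diff M (Q u) (mean_op M u)) < 1"

text \<open>
  Points of a product space indexed by a set \<open>A\<close> of coordinates are extensional functions on \<open>A\<close>.
\<close>

definition borel_of :: "'b topology \<Rightarrow> 'b measure" where
  "borel_of T = sigma (topspace T) {U. openin T U}"

definition prod_borel :: "(nat \<Rightarrow> 'a metric) \<Rightarrow> nat set \<Rightarrow> (nat \<Rightarrow> 'a) measure" where
  "prod_borel X A = borel_of (product_topology (\<lambda>k. mtopology_of (X k)) A)"

definition marginal ::
  "(nat \<Rightarrow> 'a metric) \<Rightarrow> (nat \<Rightarrow> 'a) measure \<Rightarrow> nat set \<Rightarrow> (nat \<Rightarrow> 'a) measure" where
  "marginal X \<pi> I = distr \<pi> (prod_borel X I) (\<lambda>x. restrict x I)"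

text \<open>
  For a measure \<open>M\<close> on the product indexed by \<open>A\<close>, the classes having a representative that depends
  only on the coordinates in \<open>A - J\<close>.  For \<open>J = {i}\<close> this is the space \<open>E\<^sub>i\<close>.  It is contained in,
  but for general \<open>M\<close> not equal to, the set-theoretic intersection of the spaces belonging to
  the single coordinates in \<open>J\<close>, since null sets may differ from coordinate to coordinate.
\<close>

definition const_coords ::
  "nat set \<Rightarrow> (nat \<Rightarrow> 'a) measure \<Rightarrow> nat set \<Rightarrow> ((nat \<Rightarrow> 'a) \<Rightarrow> complex) set set" where
  "const_coords A M J =
     {u \<in> L2 M. \<exists>f\<in>u. \<forall>x\<in>space M. \<forall>y\<in>space M. (\<forall>k\<in>A - J. x k = y k) \<longrightarrow> f x = f y}"

definition gibbs_step ::
  "nat set \<Rightarrow> (nat \<Rightarrow> 'a) measure \<Rightarrow> nat set \<Rightarrow> (nat \<Rightarrow> 'a) L2_op" where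
  "gibbs_step A M J = L2_proj M (const_coords A M J)"

definition gibbs_cycle ::
  "nat set \<Rightarrow> (nat \<Rightarrow> 'a) measure \<Rightarrow> nat \<Rightarrow> (nat \<Rightarrow> nat set) \<Rightarrow> (nat \<Rightarrow> 'a) L2_op" where
  "gibbs_cycle A M g J = foldr (\<circ>) (map (\<lambda>d. gibbs_step A M (J d)) [1..<Suc g]) id"

definition gibbs_mixture ::
  "nat set \<Rightarrow> (nat \<Rightarrow> 'a) measure \<Rightarrow> nat \<Rightarrow> (nat \<Rightarrow> real) \<Rightarrow> (nat \<Rightarrow> nat set) \<Rightarrow> (nat \<Rightarrow> 'a) L2_op" where
  "gibbs_mixture A M g w J u =
     L2_class M (\<lambda>x. \<Sum>d=1..g. complex_of_real (w d) * L2_rep (gibbs_step A M (J d) u) x)"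

definition block_cover :: "nat set \<Rightarrow> nat \<Rightarrow> (nat \<Rightarrow> nat set) \<Rightarrow> bool" where
  "block_cover A g J \<longleftrightarrow> (\<forall>d\<in>{1..g}. J d \<noteq> {} \<and> J d \<subset> A) \<and> (\<Union>d\<in>{1..g}. J d) = A"

definition mixture_weights :: "nat \<Rightarrow> (nat \<Rightarrow> real) \<Rightarrow> bool" where
  "mixture_weights g w \<longleftrightarrow> (\<forall>d\<in>{1..g}. 0 < w d \<and> w d < 1) \<and> (\<Sum>d=1..g. w d) = 1"

end

theory Submission
  imports Defs
begin

text \<open>
  Call a collection of closed subspaces coercive if there is \<open>c > 0\<close> such that every \<open>u\<close> of mean zero
  has distance at least \<open>c\<close> times its norm from one of them.  If a cycle or mixture \<open>Q\<close> of projections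
  has a spectral gap, then \<open>1\<close> is not in the spectrum of \<open>Q - \<Pi>\<close>, so that on mean-zero \<open>u\<close> the norm of
  \<open>u\<close> is bounded by that of \<open>u - Q u\<close>, hence by the distances of \<open>u\<close> from the subspaces: they are
  coercive.  Conversely, by Pythagoras' theorem coercivity makes every cycle and every mixture a strict
  contraction on mean-zero vectors, and a Neumann series (Banach's fixed point theorem) bounds the
  spectral radius.  Coercivity passes from the spaces \<open>E\<^sub>i\<close> to blocks, because these are smaller
  subspaces, and to the marginals, because lifting along the restriction map is isometric and lifted
  functions are constant in the discarded coordinates.
\<close>

section \<open>The space \<open>L\<^sup>2\<close>: inner product and norm\<close>

text \<open>Coercivity depends only on the set of subspaces, not on the order or the weights of the
  projections; this is why one sampler can speak for all others. A cycle is in general not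
  self-adjoint, so its spectral radius may be smaller than its norm. A gap is therefore used only
  through the resolvent at \<open>1\<close>, while the way back yields a bound on the norm of
  \<open>Q - \<Pi>\<close>, which is stronger than a bound on the spectral radius. Distances rather
  than projections enter the definition: projecting a lifted function conditions on discarded
  coordinates too and need not be the lift of the projection on the marginal space, whereas a lifted
  competitor has the same distance as the original one. Vectors are sets of functions, so the
  Hilbert space geometry is built up from representatives. The delicate point is the existence of
  projections: the spaces of functions constant in given coordinates must be complete, although
  constancy is demanded of a representative at all points and not merely almost everywhere.\<close>

lemma square_integrable_measurable [measurable_dest]:
  "f \<in> square_integrable M \<Longrightarrow> f \<in> borel_measurable M"
  by (simp add: square_integrable_def)

lemma square_integrable_integrable:
  "f \<in> square_integrable M \<Longrightarrow> integrable M (\<lambda>x. (cmod (f x))\<^sup>2)"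
  by (simp add: square_integrable_def)

lemma borel_measurable_cnj [measurable (raw)]:
  assumes "f \<in> borel_measurable M"
  shows "(\<lambda>x. cnj (f x)) \<in> borel_measurable M"
  using assms by (rule borel_measurable_continuous_on[rotated]) (intro continuous_intros)

lemma norm_diff_square_le: "(norm (a - b))\<^sup>2 \<le> 2 * (norm a)\<^sup>2 + 2 * (norm b)\<^sup>2"
  for a b :: "'a::real_normed_vector"
proof -
  have "(norm (a - b))\<^sup>2 \<le> (norm a + norm b)\<^sup>2"
    by (simp add: norm_triangle_ineq4)
  also have "\<dots> \<le> 2 * (norm a)\<^sup>2 + 2 * (norm b)\<^sup>2"
    using sum_squares_bound[of "norm a" "norm b"] by (simp add: power2_sum)
  finally show ?thesis .
qed

lemma square_integrable_scale:
  assumes f: "f \<in> square_integrable M"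
  shows "(\<lambda>x. c * f x) \<in> square_integrable M"
proof -
  note [measurable] = square_integrable_measurable[OF f]
  show ?thesis
    using square_integrable_integrable[OF f]
    by (auto simp: square_integrable_def norm_mult power_mult_distrib)
qed

lemma square_integrable_diff:
  assumes f: "f \<in> square_integrable M" and g: "g \<in> square_integrable M"
  shows "(\<lambda>x. f x - g x) \<in> square_integrable M"
proof -
  note [measurable] = square_integrable_measurable[OF f] square_integrable_measurable[OF g]
  have "integrable M (\<lambda>x. 2 * (cmod (f x))\<^sup>2 + 2 * (cmod (g x))\<^sup>2)"
    using square_integrable_integrable[OF f] square_integrable_integrable[OF g] by simp
  then have "integrable M (\<lambda>x. (cmod (f x - g x))\<^sup>2)"
    by (rule Bochner_Integration.integrable_bound) (use norm_diff_square_le in auto)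
  then show ?thesis
    by (simp add: square_integrable_def)
qed

lemma square_integrable_zero: "(\<lambda>_. 0) \<in> square_integrable M"
  by (simp add: square_integrable_def)

lemma square_integrable_add:
  assumes "f \<in> square_integrable M" "g \<in> square_integrable M"
  shows "(\<lambda>x. f x + g x) \<in> square_integrable M"
  using square_integrable_diff[OF assms(1) square_integrable_scale[OF assms(2), of "-1"]] by simp

lemma square_integrable_sum:
  assumes "\<And>i. i \<in> I \<Longrightarrow> f i \<in> square_integrable M"
  shows "(\<lambda>x. \<Sum>i\<in>I. f i x) \<in> square_integrable M"
  using assms
  by (induction I rule: infinite_finite_induct)
    (auto intro: square_integrable_add square_integrable_zero)

lemma (in finite_measure) square_integrable_const: "(\<lambda>_. c) \<in> square_integrable M"
  by (simp add: square_integrable_def)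

text \<open>Translates into the nonnegative integrals in which Cauchy-Schwarz is applied.\<close>

lemma nn_integral_square_integrable:
  assumes "f \<in> square_integrable M"
  shows "(\<integral>\<^sup>+x. (ennreal (cmod (f x)))\<^sup>2 \<partial>M) = ennreal (\<integral>x. (cmod (f x))\<^sup>2 \<partial>M)"
  using nn_integral_eq_integral[OF square_integrable_integrable[OF assms]]
  by (simp add: ennreal_power)

lemma integrable_square_integrable_mult:
  assumes f: "f \<in> square_integrable M" and g: "g \<in> square_integrable M"
  shows "integrable M (\<lambda>x. f x * cnj (g x))"
proof -
  note [measurable] = square_integrable_measurable[OF f] square_integrable_measurable[OF g]
  have "integrable M (\<lambda>x. (cmod (f x))\<^sup>2 + (cmod (g x))\<^sup>2)"
    using square_integrable_integrable[OF f] square_integrable_integrable[OF g] by simp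
  moreover have "cmod (f x * cnj (g x)) \<le> (cmod (f x))\<^sup>2 + (cmod (g x))\<^sup>2" for x
    using sum_squares_bound[of "cmod (f x)" "cmod (g x)"]
      mult_nonneg_nonneg[of "cmod (f x)" "cmod (g x)"]
    by (simp add: norm_mult del: mult_nonneg_nonneg)
  ultimately show ?thesis
    by (elim Bochner_Integration.integrable_bound) auto
qed

text \<open>Cauchy-Schwarz with the modulus inside the integral. With \<open>g\<close> constant it
  also compares L1 and L2 norms on a finite measure space, as the completeness proof
  requires.\<close>

lemma integral_norm_mult_le:
  assumes f: "f \<in> square_integrable M" and g: "g \<in> square_integrable M"
  shows "(\<integral>x. cmod (f x * cnj (g x)) \<partial>M)\<^sup>2 \<le> (\<integral>x. (cmod (f x))\<^sup>2 \<partial>M) * (\<integral>x. (cmod (g x))\<^sup>2 \<partial>M)"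
proof -
  note [measurable] = square_integrable_measurable[OF f] square_integrable_measurable[OF g]
  have int: "integrable M (\<lambda>x. cmod (f x * cnj (g x)))"
    using integrable_square_integrable_mult[OF f g] by (rule integrable_norm)
  have "ennreal ((\<integral>x. cmod (f x * cnj (g x)) \<partial>M)\<^sup>2) = (\<integral>\<^sup>+x. ennreal (cmod (f x * cnj (g x))) \<partial>M)\<^sup>2"
    using nn_integral_eq_integral[OF int] by (simp add: ennreal_power)
  also have "\<dots> = (\<integral>\<^sup>+x. ennreal (cmod (f x)) * ennreal (cmod (g x)) \<partial>M)\<^sup>2"
    by (simp add: norm_mult ennreal_mult)
  also have "\<dots> \<le> (\<integral>\<^sup>+x. (ennreal (cmod (f x)))\<^sup>2 \<partial>M) * (\<integral>\<^sup>+x. (ennreal (cmod (g x)))\<^sup>2 \<partial>M)"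
    by (rule Cauchy_Schwarz_nn_integral) measurable
  also have "\<dots> = ennreal ((\<integral>x. (cmod (f x))\<^sup>2 \<partial>M) * (\<integral>x. (cmod (g x))\<^sup>2 \<partial>M))"
    by (simp add: nn_integral_square_integrable f g ennreal_mult)
  finally show ?thesis
    by (subst (asm) ennreal_le_iff) auto
qed

section \<open>Classes, representatives and their algebra\<close>

lemma L2_class_eqI:
  assumes "AE x in M. f x = g x"
  shows "L2_class M f = L2_class M g"
  unfolding L2_class_def using assms by (auto elim: AE_mp)

lemma L2_class_self: "f \<in> square_integrable M \<Longrightarrow> f \<in> L2_class M f"
  by (simp add: L2_class_def)

lemma L2_class_eqD:
  assumes "f \<in> square_integrable M" "L2_class M f = L2_class M g"
  shows "AE x in M. f x = g x"
  using L2_class_self[OF assms(1)] unfolding assms(2) by (simp add: L2_class_def)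

lemma L2_class_in_L2: "f \<in> square_integrable M \<Longrightarrow> L2_class M f \<in> L2 M"
  by (simp add: L2_def)

lemma L2_class_member:
  assumes "u \<in> L2 M" "f \<in> u"
  shows "f \<in> square_integrable M" "L2_class M f = u"
  using assms by (auto simp: L2_def L2_class_def elim: AE_mp)

lemma L2_rep_member: "u \<in> L2 M \<Longrightarrow> L2_rep u \<in> u"
  unfolding L2_rep_def some_in_eq by (auto simp: L2_def dest: L2_class_self)

lemma L2_rep_square_integrable: "u \<in> L2 M \<Longrightarrow> L2_rep u \<in> square_integrable M"
  by (rule L2_class_member[OF _ L2_rep_member])

lemma L2_class_rep: "u \<in> L2 M \<Longrightarrow> L2_class M (L2_rep u) = u"
  by (rule L2_class_member[OF _ L2_rep_member])

lemma L2_rep_class: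
  assumes "f \<in> square_integrable M"
  shows "AE x in M. L2_rep (L2_class M f) x = f x"
  using L2_rep_member[OF L2_class_in_L2[OF assms]] by (simp add: L2_class_def)

lemma L2_cases:
  assumes "u \<in> L2 M"
  obtains f where "f \<in> square_integrable M" "u = L2_class M f"
  using assms by (auto simp: L2_def)

lemma L2_add_class:
  assumes "f \<in> square_integrable M" "g \<in> square_integrable M"
  shows "L2_add M (L2_class M f) (L2_class M g) = L2_class M (\<lambda>x. f x + g x)"
  unfolding L2_add_def
  by (rule L2_class_eqI) (use L2_rep_class[OF assms(1)] L2_rep_class[OF assms(2)] in auto)

lemma L2_diff_class:
  assumes "f \<in> square_integrable M" "g \<in> square_integrable M"
  shows "L2_diff M (L2_class M f) (L2_class M g) = L2_class M (\<lambda>x. f x - g x)"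
  unfolding L2_diff_def
  by (rule L2_class_eqI) (use L2_rep_class[OF assms(1)] L2_rep_class[OF assms(2)] in auto)

lemma L2_scale_class:
  assumes "f \<in> square_integrable M"
  shows "L2_scale M c (L2_class M f) = L2_class M (\<lambda>x. c * f x)"
  unfolding L2_scale_def by (rule L2_class_eqI) (use L2_rep_class[OF assms] in auto)

lemma L2_inner_class:
  assumes f: "f \<in> square_integrable M" and g: "g \<in> square_integrable M"
  shows "L2_inner M (L2_class M f) (L2_class M g) = (\<integral>x. f x * cnj (g x) \<partial>M)"
proof -
  note [measurable] = square_integrable_measurable[OF f] square_integrable_measurable[OF g]
    square_integrable_measurable[OF L2_rep_square_integrable[OF L2_class_in_L2[OF f]]]
    square_integrable_measurable[OF L2_rep_square_integrable[OF L2_class_in_L2[OF g]]]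
  show ?thesis
    unfolding L2_inner_def
    by (rule integral_cong_AE) (use L2_rep_class[OF f] L2_rep_class[OF g] in auto)
qed

lemma L2_norm_class:
  assumes "f \<in> square_integrable M"
  shows "L2_norm M (L2_class M f) = sqrt (\<integral>x. (cmod (f x))\<^sup>2 \<partial>M)"
proof -
  have "(\<integral>x. f x * cnj (f x) \<partial>M) = complex_of_real (\<integral>x. (cmod (f x))\<^sup>2 \<partial>M)"
    unfolding complex_norm_square[symmetric] by (rule integral_complex_of_real)
  then show ?thesis
    by (simp add: L2_norm_def L2_inner_class assms)
qed

lemma mean_op_class:
  assumes f: "f \<in> square_integrable M"
  shows "mean_op M (L2_class M f) = L2_class M (\<lambda>_. \<integral>x. f x \<partial>M)"
proof -
  note [measurable] = square_integrable_measurable[OF f]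
    square_integrable_measurable[OF L2_rep_square_integrable[OF L2_class_in_L2[OF f]]]
  have "(\<integral>x. L2_rep (L2_class M f) x \<partial>M) = (\<integral>x. f x \<partial>M)"
    by (rule integral_cong_AE) (use L2_rep_class[OF f] in auto)
  then show ?thesis
    by (simp add: mean_op_def)
qed

text \<open>The calculus for classes: once \<open>L2_cases\<close> has named functions for all
  classes involved, these rules turn an identity in \<open>L2 M\<close> into a pointwise
  one.\<close>

lemmas L2_class_simps =
  L2_add_class L2_diff_class L2_scale_class L2_inner_class mean_op_class
  square_integrable_add square_integrable_diff square_integrable_scale L2_class_in_L2

lemma L2_add_closed: "u \<in> L2 M \<Longrightarrow> v \<in> L2 M \<Longrightarrow> L2_add M u v \<in> L2 M"
  by (elim L2_cases) (simp add: L2_class_simps)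

lemma L2_diff_closed: "u \<in> L2 M \<Longrightarrow> v \<in> L2 M \<Longrightarrow> L2_diff M u v \<in> L2 M"
  by (elim L2_cases) (simp add: L2_class_simps)

lemma L2_scale_closed: "u \<in> L2 M \<Longrightarrow> L2_scale M c u \<in> L2 M"
  by (elim L2_cases) (simp add: L2_class_simps)

lemmas L2_closed = L2_add_closed L2_diff_closed L2_scale_closed

section \<open>Sesquilinearity, norm and metric\<close>

lemma L2_inner_diff_left:
  assumes "u \<in> L2 M" "v \<in> L2 M" "w \<in> L2 M"
  shows "L2_inner M (L2_diff M u v) w = L2_inner M u w - L2_inner M v w"
  using assms
  by (elim L2_cases)
    (simp add: L2_class_simps left_diff_distrib integrable_square_integrable_mult)

lemma L2_inner_add_left:
  assumes "u \<in> L2 M" "v \<in> L2 M" "w \<in> L2 M"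
  shows "L2_inner M (L2_add M u v) w = L2_inner M u w + L2_inner M v w"
  using assms
  by (elim L2_cases)
    (simp add: L2_class_simps distrib_right integrable_square_integrable_mult)

lemma L2_inner_scale_left:
  assumes "u \<in> L2 M" "v \<in> L2 M"
  shows "L2_inner M (L2_scale M c u) v = c * L2_inner M u v"
  using assms by (elim L2_cases) (simp add: L2_class_simps mult.assoc)

lemma L2_inner_commute:
  assumes "u \<in> L2 M" "v \<in> L2 M"
  shows "L2_inner M v u = cnj (L2_inner M u v)"
  using assms
proof (elim L2_cases)
  fix f g assume *: "f \<in> square_integrable M" "g \<in> square_integrable M"
    "u = L2_class M f" "v = L2_class M g"
  have "cnj (\<integral>x. f x * cnj (g x) \<partial>M) = (\<integral>x. cnj (f x * cnj (g x)) \<partial>M)"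
    by (rule Bochner_Integration.integral_cnj[symmetric])
  then show ?thesis
    using * by (simp add: L2_class_simps mult.commute)
qed

lemma L2_inner_diff_right:
  assumes "u \<in> L2 M" "v \<in> L2 M" "w \<in> L2 M"
  shows "L2_inner M w (L2_diff M u v) = L2_inner M w u - L2_inner M w v"
  using L2_inner_commute[of "L2_diff M u v" M w] assms
  by (simp add: L2_closed L2_inner_diff_left L2_inner_commute[of w M u] L2_inner_commute[of w M v])

lemma L2_inner_scale_right:
  assumes "u \<in> L2 M" "v \<in> L2 M"
  shows "L2_inner M u (L2_scale M c v) = cnj c * L2_inner M u v"
  using L2_inner_commute[of "L2_scale M c v" M u] assms
  by (simp add: L2_closed L2_inner_scale_left L2_inner_commute[of u M v])

lemma L2_norm_nonneg:
  assumes "u \<in> L2 M"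
  shows "0 \<le> L2_norm M u"
  using assms by (elim L2_cases) (simp add: L2_norm_class)

lemma L2_inner_self:
  assumes "u \<in> L2 M"
  shows "L2_inner M u u = complex_of_real ((L2_norm M u)\<^sup>2)"
  using assms
proof (elim L2_cases)
  fix f assume *: "f \<in> square_integrable M" "u = L2_class M f"
  have "(\<integral>x. f x * cnj (f x) \<partial>M) = complex_of_real (\<integral>x. (cmod (f x))\<^sup>2 \<partial>M)"
    unfolding complex_norm_square[symmetric] by (rule integral_complex_of_real)
  then show ?thesis
    using * by (simp add: L2_class_simps L2_norm_class)
qed

lemma L2_norm_diff_square:
  assumes "u \<in> L2 M" "v \<in> L2 M"
  shows "(L2_norm M (L2_diff M u v))\<^sup>2 = (L2_norm M u)\<^sup>2 - 2 * Re (L2_inner M u v) + (L2_norm M v)\<^sup>2"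
proof -
  have "complex_of_real ((L2_norm M (L2_diff M u v))\<^sup>2) =
      L2_inner M u u - L2_inner M u v - (cnj (L2_inner M u v) - L2_inner M v v)"
    using assms by (simp add: L2_inner_self[symmetric] L2_closed L2_inner_diff_left
        L2_inner_diff_right L2_inner_commute[of u M v] del: of_real_power)
  then have "(L2_norm M (L2_diff M u v))\<^sup>2 =
      Re (L2_inner M u u - L2_inner M u v - (cnj (L2_inner M u v) - L2_inner M v v))"
    by (metis Re_complex_of_real)
  then show ?thesis
    by (simp add: L2_inner_self assms)
qed

lemma L2_inner_le_norm:
  assumes "u \<in> L2 M" "v \<in> L2 M"
  shows "cmod (L2_inner M u v) \<le> L2_norm M u * L2_norm M v"
  using assms
proof (elim L2_cases)
  fix f g assume *: "f \<in> square_integrable M" "g \<in> square_integrable M"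
    "u = L2_class M f" "v = L2_class M g"
  have "cmod (L2_inner M u v) \<le> (\<integral>x. cmod (f x * cnj (g x)) \<partial>M)"
    using * by (simp add: L2_class_simps del: norm_mult complex_mod_cnj)
  also have "\<dots> \<le> L2_norm M u * L2_norm M v"
    using integral_norm_mult_le[OF *(1,2)] * real_le_rsqrt
    by (simp add: L2_norm_class real_sqrt_mult[symmetric])
  finally show ?thesis .
qed

lemma L2_norm_diff_le:
  assumes "u \<in> L2 M" "v \<in> L2 M"
  shows "L2_norm M (L2_diff M u v) \<le> L2_norm M u + L2_norm M v"
proof -
  have "- Re (L2_inner M u v) \<le> L2_norm M u * L2_norm M v"
    using L2_inner_le_norm[OF assms] abs_Re_le_cmod[of "L2_inner M u v"] by linarith
  then have "(L2_norm M (L2_diff M u v))\<^sup>2 \<le> (L2_norm M u + L2_norm M v)\<^sup>2"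
    by (simp add: L2_norm_diff_square assms power2_sum)
  then show ?thesis
    by (rule power2_le_imp_le) (simp add: L2_norm_nonneg assms)
qed

lemma L2_norm_scale:
  assumes "u \<in> L2 M"
  shows "L2_norm M (L2_scale M c u) = cmod c * L2_norm M u"
  using assms
  by (elim L2_cases)
    (simp add: L2_class_simps L2_norm_class norm_mult power_mult_distrib real_sqrt_mult)

lemma L2_norm_diff_commute:
  assumes "u \<in> L2 M" "v \<in> L2 M"
  shows "L2_norm M (L2_diff M u v) = L2_norm M (L2_diff M v u)"
  using assms by (elim L2_cases) (simp add: L2_class_simps L2_norm_class norm_minus_commute)

text \<open>A nonnegative integrand with integral zero vanishes almost everywhere, and passing to
  classes turns this into equality.\<close>

lemma L2_norm_diff_eq_0:
  assumes "u \<in> L2 M" "v \<in> L2 M"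
  shows "L2_norm M (L2_diff M u v) = 0 \<longleftrightarrow> u = v"
  using assms
proof (elim L2_cases)
  fix f g assume *: "f \<in> square_integrable M" "g \<in> square_integrable M"
    "u = L2_class M f" "v = L2_class M g"
  have "L2_norm M (L2_diff M u v) = 0 \<longleftrightarrow> (\<integral>x. (cmod (f x - g x))\<^sup>2 \<partial>M) = 0"
    using * by (simp add: L2_class_simps L2_norm_class)
  also have "\<dots> \<longleftrightarrow> (AE x in M. (cmod (f x - g x))\<^sup>2 = 0)"
    using square_integrable_integrable[OF square_integrable_diff[OF *(1,2)]]
    by (intro integral_nonneg_eq_0_iff_AE) auto
  also have "\<dots> \<longleftrightarrow> (AE x in M. f x = g x)"
    by simp
  also have "\<dots> \<longleftrightarrow> u = v"
    using * L2_class_eqI L2_class_eqD by metis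
  finally show ?thesis .
qed

lemma L2_diff_diff:
  assumes "u \<in> L2 M" "v \<in> L2 M" "w \<in> L2 M"
  shows "L2_diff M (L2_diff M u w) (L2_diff M v w) = L2_diff M u v"
  using assms by (elim L2_cases) (simp add: L2_class_simps)

lemma L2_norm_triangle:
  assumes "u \<in> L2 M" "v \<in> L2 M" "w \<in> L2 M"
  shows "L2_norm M (L2_diff M u w) \<le> L2_norm M (L2_diff M u v) + L2_norm M (L2_diff M v w)"
  using L2_norm_diff_le[of "L2_diff M u v" M "L2_diff M w v"] assms
  by (simp add: L2_diff_diff L2_closed L2_norm_diff_commute)

text \<open>\<^locale>\<open>Metric_space\<close> asks for symmetry and nonnegativity also off the carrier, hence the guard.\<close>

definition L2_dist :: "'b measure \<Rightarrow> ('b \<Rightarrow> complex) set \<Rightarrow> ('b \<Rightarrow> complex) set \<Rightarrow> real" where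
  "L2_dist M u v = (if u \<in> L2 M \<and> v \<in> L2 M then L2_norm M (L2_diff M u v) else 0)"

lemma Metric_space_L2_dist:
  assumes "F \<subseteq> L2 M"
  shows "Metric_space F (L2_dist M)"
proof
  fix u v
  show "0 \<le> L2_dist M u v"
    by (simp add: L2_dist_def L2_norm_nonneg L2_closed)
  show "L2_dist M u v = L2_dist M v u"
    by (auto simp: L2_dist_def L2_norm_diff_commute)
next
  fix u v w assume "u \<in> F" "v \<in> F" "w \<in> F"
  then have *: "u \<in> L2 M" "v \<in> L2 M" "w \<in> L2 M"
    using assms by auto
  show "L2_dist M u v = 0 \<longleftrightarrow> u = v"
    using * by (simp add: L2_dist_def L2_norm_diff_eq_0)
  show "L2_dist M u w \<le> L2_dist M u v + L2_dist M v w"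
    using * by (simp add: L2_dist_def L2_norm_triangle)
qed

section \<open>Completeness\<close>

text \<open>Riesz-Fischer. The limit is exhibited as a pointwise \<open>lim\<close> along a
  subsequence, defined at every point, so that an equality between the values at two points that
  holds for all \<open>f n\<close> is inherited exactly.\<close>

lemma (in finite_measure) L2_Cauchy_limit:
  assumes f: "\<And>n. f n \<in> square_integrable M"
    and Cauchy: "\<And>e. e > 0 \<Longrightarrow> \<exists>N. \<forall>m\<ge>N. \<forall>n\<ge>N. (\<integral>x. (cmod (f m x - f n x))\<^sup>2 \<partial>M) < e"
  obtains r :: "nat \<Rightarrow> nat" where
    "(\<lambda>x. lim (\<lambda>k. f (r k) x)) \<in> square_integrable M"
    "(\<lambda>n. \<integral>x. (cmod (f n x - lim (\<lambda>k. f (r k) x)))\<^sup>2 \<partial>M) \<longlonglongrightarrow> 0"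
proof -
  note [measurable] = square_integrable_measurable[OF f]
  define \<mu> where "\<mu> = measure M (space M)"
  \<comment> \<open>Cauchy-Schwarz against the constant \<open>1\<close>; \<open>\<mu>\<close> is
    the total mass.\<close>
  have L1: "(\<integral>x. cmod (f m x - f n x) \<partial>M)\<^sup>2 \<le> (\<integral>x. (cmod (f m x - f n x))\<^sup>2 \<partial>M) * \<mu>" for m n
    using integral_norm_mult_le[OF square_integrable_diff[OF f f] square_integrable_const[of 1], of m n]
    by (simp add: \<mu>_def)
  have int: "integrable M (f n)" for n
    using integrable_square_integrable_mult[OF f square_integrable_const[of 1]] by simp
  have "\<exists>N. \<forall>m\<ge>N. \<forall>n\<ge>N. (\<integral>x. cmod (f m x - f n x) \<partial>M) < e" if "e > 0" for e
  proof -
    have \<mu>: "0 \<le> \<mu>"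
      by (simp add: \<mu>_def)
    \<comment> \<open>The \<open>+ 1\<close> guards against total mass zero and makes the final
      inequality strict.\<close>
    then obtain N where N: "\<forall>m\<ge>N. \<forall>n\<ge>N. (\<integral>x. (cmod (f m x - f n x))\<^sup>2 \<partial>M) < e\<^sup>2 / (\<mu> + 1)"
      using Cauchy[of "e\<^sup>2 / (\<mu> + 1)"] \<open>e > 0\<close> by auto
    have "(\<integral>x. cmod (f m x - f n x) \<partial>M) < e" if "m \<ge> N" "n \<ge> N" for m n
    proof -
      have "(\<integral>x. cmod (f m x - f n x) \<partial>M)\<^sup>2 \<le> e\<^sup>2 / (\<mu> + 1) * \<mu>"
        using N that by (intro order_trans[OF L1] mult_right_mono \<mu>) (auto simp: less_imp_le)
      also have "\<dots> < e\<^sup>2"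
        using \<mu> \<open>e > 0\<close> by (simp add: field_simps)
      finally show ?thesis
        by (rule power2_less_imp_less) (use \<open>e > 0\<close> in simp)
    qed
    then show ?thesis
      by blast
  qed
  \<comment> \<open>The subsequence comes from the L1 Cauchy property. Where it diverges, which
    happens only inside a null set, \<open>lim\<close> takes some unspecified value.\<close>
  from cauchy_L1_AE_cauchy_subseq[OF int this] obtain r where
    r: "strict_mono r" and "AE x in M. Cauchy (\<lambda>k. f (r k) x)"
    by blast
  define h where "h = (\<lambda>x. lim (\<lambda>k. f (r k) x))"
  have h_lim: "AE x in M. (\<lambda>k. f (r k) x) \<longlonglongrightarrow> h x"
    using \<open>AE x in M. Cauchy (\<lambda>k. f (r k) x)\<close>
    unfolding h_def by eventually_elim (simp add: Cauchy_convergent_iff convergent_LIMSEQ_iff)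
  have [measurable]: "h \<in> borel_measurable M"
    unfolding h_def by measurable
  \<comment> \<open>Fatou's lemma along the subsequence: the bound \<open>e\<close> on the squared
    distance of \<open>f n\<close> and \<open>f (r k)\<close> survives as \<open>k\<close> tends to
    infinity.\<close>
  have Fatou: "\<exists>N. \<forall>n\<ge>N. (\<integral>\<^sup>+x. ennreal ((cmod (f n x - h x))\<^sup>2) \<partial>M) \<le> ennreal e" if "e > 0" for e
  proof -
    obtain N where N: "\<And>m n. m \<ge> N \<Longrightarrow> n \<ge> N \<Longrightarrow> (\<integral>x. (cmod (f m x - f n x))\<^sup>2 \<partial>M) < e"
      using Cauchy[OF \<open>e > 0\<close>] by blast
    have "(\<integral>\<^sup>+x. ennreal ((cmod (f n x - h x))\<^sup>2) \<partial>M) \<le> ennreal e" if "n \<ge> N" for n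
    proof -
      have "(\<integral>\<^sup>+x. ennreal ((cmod (f n x - h x))\<^sup>2) \<partial>M) =
          (\<integral>\<^sup>+x. liminf (\<lambda>k. ennreal ((cmod (f n x - f (r k) x))\<^sup>2)) \<partial>M)"
        using h_lim
        by (intro nn_integral_cong_AE, eventually_elim, intro lim_imp_Liminf[symmetric])
          (auto intro!: tendsto_intros)
      also have "\<dots> \<le> liminf (\<lambda>k. \<integral>\<^sup>+x. ennreal ((cmod (f n x - f (r k) x))\<^sup>2) \<partial>M)"
        by (rule nn_integral_liminf) measurable
      also have "\<dots> = liminf (\<lambda>k. ennreal (\<integral>x. (cmod (f n x - f (r k) x))\<^sup>2 \<partial>M))"
        using square_integrable_integrable[OF square_integrable_diff[OF f f]]
        by (intro arg_cong[where f = liminf] ext nn_integral_eq_integral) auto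
      also have "\<dots> \<le> ennreal e"
      proof (rule Liminf_le)
        show "\<forall>\<^sub>F k in sequentially. ennreal (\<integral>x. (cmod (f n x - f (r k) x))\<^sup>2 \<partial>M) \<le> ennreal e"
          using eventually_ge_at_top[of N]
        proof eventually_elim
          fix k assume "k \<ge> N"
          then have "r k \<ge> N"
            using seq_suble[OF r, of k] by simp
          then show "ennreal (\<integral>x. (cmod (f n x - f (r k) x))\<^sup>2 \<partial>M) \<le> ennreal e"
            using N[OF \<open>n \<ge> N\<close>] by (intro ennreal_leI) (simp add: less_imp_le)
        qed
      qed simp
      finally show ?thesis .
    qed
    then show ?thesis
      by blast
  qed
  \<comment> \<open>Write \<open>h\<close> as \<open>f n - (f n - h)\<close>, where the second term
    is square-integrable by the Fatou bound for a single large \<open>n\<close>.\<close>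
  have h: "h \<in> square_integrable M"
  proof -
    obtain n where "(\<integral>\<^sup>+x. ennreal ((cmod (f n x - h x))\<^sup>2) \<partial>M) \<le> ennreal 1"
      using Fatou[of 1] by auto
    then have "(\<lambda>x. f n x - h x) \<in> square_integrable M"
      by (auto simp: square_integrable_def integrable_iff_bounded ennreal_power
          intro: le_less_trans)
    from square_integrable_diff[OF f this, of n] show ?thesis
      by simp
  qed
  have "(\<lambda>n. \<integral>x. (cmod (f n x - h x))\<^sup>2 \<partial>M) \<longlonglongrightarrow> 0"
  proof (rule LIMSEQ_I)
    fix e :: real assume "e > 0"
    then obtain N where N: "\<forall>n\<ge>N. (\<integral>\<^sup>+x. ennreal ((cmod (f n x - h x))\<^sup>2) \<partial>M) \<le> ennreal (e / 2)"
      using Fatou[of "e / 2"] by auto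
    have "norm ((\<integral>x. (cmod (f n x - h x))\<^sup>2 \<partial>M) - 0) < e" if "n \<ge> N" for n
    proof -
      have "ennreal (\<integral>x. (cmod (f n x - h x))\<^sup>2 \<partial>M) \<le> ennreal (e / 2)"
        using N that square_integrable_integrable[OF square_integrable_diff[OF f h]]
        by (subst nn_integral_eq_integral[symmetric]) auto
      then show ?thesis
        using \<open>e > 0\<close> by (simp add: ennreal_le_iff)
    qed
    then show "\<exists>N. \<forall>n\<ge>N. norm ((\<integral>x. (cmod (f n x - h x))\<^sup>2 \<partial>M) - 0) < e"
      by blast
  qed
  with h show thesis
    unfolding h_def by (rule that)
qed

lemma L2_dist_class:
  assumes "f \<in> square_integrable M" "g \<in> square_integrable M"
  shows "L2_dist M (L2_class M f) (L2_class M g) = sqrt (\<integral>x. (cmod (f x - g x))\<^sup>2 \<partial>M)"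
  using assms by (simp add: L2_dist_def L2_class_simps L2_norm_class)

lemma mcomplete_L2_distI:
  assumes F: "F \<subseteq> L2 M"
    and lim: "\<And>s. \<lbrakk>\<And>n. s n \<in> F; \<And>e. e > 0 \<Longrightarrow> \<exists>N. \<forall>m\<ge>N. \<forall>n\<ge>N. L2_dist M (s m) (s n) < e\<rbrakk>
      \<Longrightarrow> \<exists>u\<in>F. (\<lambda>n. L2_dist M (s n) u) \<longlonglongrightarrow> 0"
  shows "Metric_space.mcomplete F (L2_dist M)"
proof -
  interpret Metric_space F "L2_dist M"
    using F by (rule Metric_space_L2_dist)
  have "\<exists>u. limitin mtopology s u sequentially" if "MCauchy s" for s
  proof -
    have s: "s n \<in> F" for n
      using that by (auto simp: MCauchy_def)
    moreover have "\<exists>N. \<forall>m\<ge>N. \<forall>n\<ge>N. L2_dist M (s m) (s n) < e" if "e > 0" for e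
      using \<open>MCauchy s\<close> that by (simp add: MCauchy_def)
    ultimately obtain u where "u \<in> F" "(\<lambda>n. L2_dist M (s n) u) \<longlonglongrightarrow> 0"
      using lim[of s] by blast
    then show ?thesis
      using s by (auto simp: limitin_metric_dist_null)
  qed
  then show ?thesis
    by (simp add: mcomplete_def)
qed

text \<open>\<open>R\<close> abstracts agreement in the retained coordinates, and the empty relation
  gives the whole space. One statement thus serves both the fixed-point theorem on
  \<open>L2 M\<close> and the existence of projections.\<close>

lemma (in finite_measure) mcomplete_L2_respecting:
  fixes R :: "'a \<Rightarrow> 'a \<Rightarrow> bool"
  defines "F \<equiv> {u \<in> L2 M. \<exists>f\<in>u. \<forall>x y. R x y \<longrightarrow> f x = f y}"
  shows "Metric_space.mcomplete F (L2_dist M)"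
proof (rule mcomplete_L2_distI)
  show "F \<subseteq> L2 M"
    by (auto simp: F_def)
next
  fix s :: "nat \<Rightarrow> ('a \<Rightarrow> complex) set"
  assume s: "\<And>n. s n \<in> F"
    and Cauchy: "\<And>e. e > 0 \<Longrightarrow> \<exists>N. \<forall>m\<ge>N. \<forall>n\<ge>N. L2_dist M (s m) (s n) < e"
  have "\<forall>n. \<exists>f. f \<in> s n \<and> (\<forall>x y. R x y \<longrightarrow> f x = f y)"
    using s unfolding F_def by blast
  then obtain f where fs: "f n \<in> s n" and R: "R x y \<Longrightarrow> f n x = f n y" for n x y
    by (metis (no_types))
  have f: "f n \<in> square_integrable M" and s_eq: "s n = L2_class M (f n)" for n
    using L2_class_member[OF _ fs] s by (auto simp: F_def)
  have "\<exists>N. \<forall>m\<ge>N. \<forall>n\<ge>N. (\<integral>x. (cmod (f m x - f n x))\<^sup>2 \<partial>M) < e" if "e > 0" for e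
    using Cauchy[of "sqrt e"] that by (simp add: s_eq L2_dist_class f)
  from L2_Cauchy_limit[OF f this] obtain r where
    h: "(\<lambda>x. lim (\<lambda>k. f (r k) x)) \<in> square_integrable M" (is "?h \<in> _")
    and lim: "(\<lambda>n. \<integral>x. (cmod (f n x - lim (\<lambda>k. f (r k) x)))\<^sup>2 \<partial>M) \<longlonglongrightarrow> 0"
    by blast
  \<comment> \<open>The sequences \<open>f (r k) x\<close> and \<open>f (r k) y\<close> coincide, so
    their \<open>lim\<close> agree even where neither converges.\<close>
  have "?h x = ?h y" if "R x y" for x y
    using R[OF that] by simp
  then have "L2_class M ?h \<in> F"
    unfolding F_def
    by (intro CollectI conjI bexI[of _ ?h] L2_class_in_L2 L2_class_self h) simp
  moreover have "(\<lambda>n. L2_dist M (s n) (L2_class M ?h)) \<longlonglongrightarrow> 0"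
    using tendsto_real_sqrt[OF lim] by (simp add: s_eq L2_dist_class f h)
  ultimately show "\<exists>u\<in>F. (\<lambda>n. L2_dist M (s n) u) \<longlonglongrightarrow> 0"
    by blast
qed

lemma (in finite_measure) mcomplete_L2: "Metric_space.mcomplete (L2 M) (L2_dist M)"
proof -
  have "{u \<in> L2 M. \<exists>f\<in>u. \<forall>x y. False \<longrightarrow> f x = f y} = L2 M"
    using L2_rep_member by auto
  then show ?thesis
    using mcomplete_L2_respecting[of "\<lambda>_ _. False"] by simp
qed

section \<open>Orthogonal projections\<close>

text \<open>Closedness is encoded as completeness of \<open>F\<close> in its own metric, the form in
  which minimising sequences use it.\<close>

definition L2_subspace :: "'b measure \<Rightarrow> ('b \<Rightarrow> complex) set set \<Rightarrow> bool" where
  "L2_subspace M F \<longleftrightarrow> F \<subseteq> L2 M \<and> F \<noteq> {} \<and>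
     (\<forall>u\<in>F. \<forall>v\<in>F. L2_add M u v \<in> F) \<and> (\<forall>c. \<forall>u\<in>F. L2_scale M c u \<in> F) \<and>
     Metric_space.mcomplete F (L2_dist M)"

lemma L2_norm_class_square:
  assumes "f \<in> square_integrable M"
  shows "(L2_norm M (L2_class M f))\<^sup>2 = (\<integral>x. (cmod (f x))\<^sup>2 \<partial>M)"
  by (simp add: L2_norm_class assms)

text \<open>The parallelogram law for \<open>u - a\<close> and \<open>u - b\<close>, whose sum is
  twice the difference of \<open>u\<close> and the midpoint; checked pointwise on real and imaginary
  parts, then integrated.\<close>

lemma L2_parallelogram:
  assumes "u \<in> L2 M" "a \<in> L2 M" "b \<in> L2 M"
  shows "(L2_norm M (L2_diff M a b))\<^sup>2 =
    2 * (L2_norm M (L2_diff M u a))\<^sup>2 + 2 * (L2_norm M (L2_diff M u b))\<^sup>2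
    - 4 * (L2_norm M (L2_diff M u (L2_scale M (1 / 2) (L2_add M a b))))\<^sup>2"
  using assms
proof (elim L2_cases)
  fix f g h assume fgh: "f \<in> square_integrable M" "g \<in> square_integrable M" "h \<in> square_integrable M"
    "u = L2_class M f" "a = L2_class M g" "b = L2_class M h"
  have sq: "(\<lambda>x. f x - g x) \<in> square_integrable M" "(\<lambda>x. f x - h x) \<in> square_integrable M"
    "(\<lambda>x. f x - (1 / 2) * (g x + h x)) \<in> square_integrable M"
    using fgh by (auto intro!: square_integrable_diff square_integrable_add square_integrable_scale
        simp del: times_divide_eq_left)
  have "(\<integral>x. (cmod (g x - h x))\<^sup>2 \<partial>M) = (\<integral>x. 2 * (cmod (f x - g x))\<^sup>2 + 2 * (cmod (f x - h x))\<^sup>2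
      - 4 * (cmod (f x - (1 / 2) * (g x + h x)))\<^sup>2 \<partial>M)"
    by (rule Bochner_Integration.integral_cong)
      (auto simp only: cmod_power2, simp add: power2_eq_square field_simps)
  also have "\<dots> = 2 * (\<integral>x. (cmod (f x - g x))\<^sup>2 \<partial>M) + 2 * (\<integral>x. (cmod (f x - h x))\<^sup>2 \<partial>M)
      - 4 * (\<integral>x. (cmod (f x - (1 / 2) * (g x + h x)))\<^sup>2 \<partial>M)"
    using sq[THEN square_integrable_integrable] by simp
  finally show ?thesis
    using fgh sq by (simp add: L2_class_simps L2_norm_class_square del: times_divide_eq_left)
qed

lemma L2_diff_eq_add_scale:
  assumes "u \<in> L2 M" "v \<in> L2 M"
  shows "L2_diff M u v = L2_add M u (L2_scale M (-1) v)"
  using assms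
  by (elim L2_cases)
    (simp only: L2_scale_class L2_diff_class L2_add_class square_integrable_scale, simp)

lemma L2_subspace_diff:
  assumes "L2_subspace M F" "u \<in> F" "v \<in> F"
  shows "L2_diff M u v \<in> F"
proof -
  have "u \<in> L2 M" "v \<in> L2 M"
    using assms by (auto simp: L2_subspace_def)
  then show ?thesis
    using assms by (simp add: L2_diff_eq_add_scale L2_subspace_def)
qed

lemma L2_diff_add_scale:
  assumes "u \<in> L2 M" "v \<in> L2 M" "w \<in> L2 M"
  shows "L2_diff M u (L2_add M v (L2_scale M c w)) = L2_diff M (L2_diff M u v) (L2_scale M c w)"
  using assms by (elim L2_cases) (simp add: L2_class_simps algebra_simps)

text \<open>A minimising sequence is Cauchy because midpoints stay in \<open>F\<close> and so cannot
  be closer to \<open>u\<close> than the infimum.\<close>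

lemma L2_subspace_nearest_point:
  assumes F: "L2_subspace M F" and u: "u \<in> L2 M"
  obtains v where "v \<in> F" "\<And>w. w \<in> F \<Longrightarrow> L2_norm M (L2_diff M u v) \<le> L2_norm M (L2_diff M u w)"
proof -
  have sub: "F \<subseteq> L2 M" and ne: "F \<noteq> {}" and
    mid: "\<And>v w. v \<in> F \<Longrightarrow> w \<in> F \<Longrightarrow> L2_scale M (1 / 2) (L2_add M v w) \<in> F"
    using F by (auto simp: L2_subspace_def)
  interpret Metric_space F "L2_dist M"
    using sub by (rule Metric_space_L2_dist)
  define D where "D w = L2_norm M (L2_diff M u w)" for w
  define d where "d = (INF w\<in>F. (D w)\<^sup>2)"
  have bdd: "bdd_below ((\<lambda>w. (D w)\<^sup>2) ` F)"
    by (auto intro!: bdd_belowI[of _ 0])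
  have d_le: "d \<le> (D w)\<^sup>2" if "w \<in> F" for w
    unfolding d_def using bdd that by (rule cINF_lower)
  have D_nonneg: "0 \<le> D w" if "w \<in> F" for w
    using that sub u by (auto simp: D_def intro: L2_norm_nonneg L2_closed)
  have "\<exists>w\<in>F. (D w)\<^sup>2 < d + inverse (real (Suc n))" for n
    by (subst cINF_less_iff[OF ne bdd, symmetric]) (simp add: d_def)
  then obtain s where s: "\<And>n. s n \<in> F" and s_less: "\<And>n. (D (s n))\<^sup>2 < d + inverse (real (Suc n))"
    by metis
  \<comment> \<open>Two squared distances below \<open>d + 1 / (N + 1)\<close> and a midpoint at
    squared distance at least \<open>d\<close> leave \<open>4 / (N + 1)\<close> in the parallelogram
    law.\<close>
  have close: "(L2_dist M (s m) (s n))\<^sup>2 \<le> 4 * inverse (real (Suc N))" if "m \<ge> N" "n \<ge> N" for m n N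
  proof -
    have "(L2_dist M (s m) (s n))\<^sup>2 =
        2 * (D (s m))\<^sup>2 + 2 * (D (s n))\<^sup>2 - 4 * (D (L2_scale M (1 / 2) (L2_add M (s m) (s n))))\<^sup>2"
      using L2_parallelogram[of u M "s m" "s n"] s sub u by (auto simp: L2_dist_def D_def)
    moreover have "inverse (real (Suc m)) \<le> inverse (real (Suc N))"
      "inverse (real (Suc n)) \<le> inverse (real (Suc N))"
      using that by (auto intro!: le_imp_inverse_le)
    ultimately show ?thesis
      using s_less[of m] s_less[of n] d_le[OF mid[OF s s], of m n] by linarith
  qed
  have "MCauchy s"
    unfolding MCauchy_def
  proof (intro conjI allI impI)
    show "range s \<subseteq> F"
      using s by auto
    fix e :: real assume "e > 0"
    obtain N where N: "inverse (real (Suc N)) < e\<^sup>2 / 4"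
      using reals_Archimedean[of "e\<^sup>2 / 4"] \<open>e > 0\<close> by auto
    have "L2_dist M (s m) (s n) < e" if "m \<ge> N" "n \<ge> N" for m n
      using close[OF that] N \<open>e > 0\<close> by (intro power2_less_imp_less[of _ e]) linarith+
    then show "\<exists>N. \<forall>n n'. N \<le> n \<longrightarrow> N \<le> n' \<longrightarrow> L2_dist M (s n) (s n') < e"
      by blast
  qed
  then obtain v where "limitin mtopology s v sequentially"
    using F unfolding L2_subspace_def mcomplete_def by blast
  then have v: "v \<in> F" and lim: "(\<lambda>n. L2_dist M (s n) v) \<longlonglongrightarrow> 0"
    by (auto simp: limitin_metric_dist_null)
  \<comment> \<open>The added zeros are the limits of the two error terms, kept so that the limit
    matches term by term.\<close>
  have "D v \<le> sqrt (d + 0) + 0"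
  proof (rule LIMSEQ_le_const)
    show "(\<lambda>n. sqrt (d + inverse (real (Suc n))) + L2_dist M (s n) v) \<longlonglongrightarrow> sqrt (d + 0) + 0"
      by (intro tendsto_intros LIMSEQ_inverse_real_of_nat lim)
    have "D v \<le> sqrt (d + inverse (real (Suc n))) + L2_dist M (s n) v" for n
    proof -
      have "D v \<le> D (s n) + L2_dist M (s n) v"
        using L2_norm_triangle[of u M "s n" v] s[of n] v sub u by (auto simp: D_def L2_dist_def)
      moreover have "D (s n) \<le> sqrt (d + inverse (real (Suc n)))"
        using s_less[of n] by (intro real_le_rsqrt) simp
      ultimately show ?thesis
        by simp
    qed
    then show "\<exists>N. \<forall>n\<ge>N. D v \<le> sqrt (d + inverse (real (Suc n))) + L2_dist M (s n) v"
      by blast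
  qed
  moreover have "sqrt d \<le> D w" if "w \<in> F" for w
    using d_le[OF that] D_nonneg[OF that] by (simp add: real_le_lsqrt)
  ultimately have "D v \<le> D w" if "w \<in> F" for w
    using that by fastforce
  with v show thesis
    by (intro that) (auto simp: D_def)
qed

text \<open>If the inner product were some \<open>\<alpha> \<noteq> 0\<close>, moving
  \<open>v\<close> by a suitable positive multiple of \<open>\<alpha> w\<close> would reduce the
  squared distance.\<close>

lemma L2_nearest_point_orthogonal:
  assumes F: "L2_subspace M F" and u: "u \<in> L2 M" and v: "v \<in> F"
    and near: "\<And>w. w \<in> F \<Longrightarrow> L2_norm M (L2_diff M u v) \<le> L2_norm M (L2_diff M u w)"
    and w: "w \<in> F"
  shows "L2_inner M (L2_diff M u v) w = 0"
proof (rule ccontr)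
  define \<alpha> where "\<alpha> = L2_inner M (L2_diff M u v) w"
  \<comment> \<open>The best factor would be \<open>1 / (L2_norm M w)\<^sup>2\<close>; the
    \<open>+ 1\<close> keeps it defined for \<open>w\<close> of norm zero and still gives
    \<open>t * (L2_norm M w)\<^sup>2 < 1\<close>.\<close>
  define t where "t = 1 / ((L2_norm M w)\<^sup>2 + 1)"
  assume "L2_inner M (L2_diff M u v) w \<noteq> 0"
  then have \<alpha>: "(cmod \<alpha>)\<^sup>2 > 0"
    by (simp add: \<alpha>_def)
  have t: "t > 0"
    by (auto simp: t_def intro: add_nonneg_pos)
  have L2: "v \<in> L2 M" "w \<in> L2 M"
    using F v w by (auto simp: L2_subspace_def)
  let ?z = "L2_scale M (of_real t * \<alpha>) w"
  have "L2_add M v ?z \<in> F"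
    using F v w by (auto simp: L2_subspace_def)
  from near[OF this]
  have "(L2_norm M (L2_diff M u v))\<^sup>2 \<le> (L2_norm M (L2_diff M (L2_diff M u v) ?z))\<^sup>2"
    using u L2 by (simp add: L2_diff_add_scale L2_norm_nonneg L2_closed power_mono)
  also have "\<dots> = (L2_norm M (L2_diff M u v))\<^sup>2 - 2 * (t * (cmod \<alpha>)\<^sup>2) + (t * cmod \<alpha> * L2_norm M w)\<^sup>2"
  proof -
    have "L2_inner M (L2_diff M u v) ?z = of_real (t * (cmod \<alpha>)\<^sup>2)"
      using u L2 by (simp add: L2_inner_scale_right L2_closed \<alpha>_def[symmetric] complex_norm_square
          mult_ac del: of_real_power)
    then show ?thesis
      using u L2 t
      by (simp add: L2_norm_diff_square L2_closed L2_norm_scale norm_mult)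
  qed
  finally have "(t * (cmod \<alpha>)\<^sup>2) * 2 \<le> (t * (cmod \<alpha>)\<^sup>2) * (t * (L2_norm M w)\<^sup>2)"
    by (simp add: power2_eq_square mult_ac)
  then have "2 \<le> t * (L2_norm M w)\<^sup>2"
    using \<alpha> t by (subst (asm) mult_le_cancel_left_pos) auto
  also have "\<dots> < 1"
    by (simp add: t_def add_nonneg_pos)
  finally show False
    by simp
qed

text \<open>The difference of two candidates lies in \<open>F\<close> and is orthogonal to
  \<open>F\<close>, hence to itself.\<close>

lemma L2_orthogonal_unique:
  assumes F: "L2_subspace M F" and u: "u \<in> L2 M" and v: "v \<in> F" "v' \<in> F"
    and orth: "\<And>w. w \<in> F \<Longrightarrow> L2_inner M (L2_diff M u v) w = 0"
      "\<And>w. w \<in> F \<Longrightarrow> L2_inner M (L2_diff M u v') w = 0"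
  shows "v = v'"
proof -
  have L2: "v \<in> L2 M" "v' \<in> L2 M"
    using F v by (auto simp: L2_subspace_def)
  have w: "L2_diff M v v' \<in> F"
    using F v by (rule L2_subspace_diff)
  have "L2_inner M (L2_diff M v v') (L2_diff M v v') = 0"
    using orth[OF w] u L2 by (simp add: L2_inner_diff_left L2_closed)
  then show ?thesis
    using L2 by (simp add: L2_inner_self L2_closed L2_norm_diff_eq_0)
qed

text \<open>Discharges the \<open>THE\<close> in \<open>L2_proj\<close>: linearity and fixed points
  of projections are then proved by exhibiting the value and testing orthogonality.\<close>

lemma L2_proj_eqI:
  assumes "L2_subspace M F" "u \<in> L2 M" "v \<in> F" "\<And>w. w \<in> F \<Longrightarrow> L2_inner M (L2_diff M u v) w = 0"
  shows "L2_proj M F u = v"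
  unfolding L2_proj_def
proof (rule the_equality)
  show "v' = v" if "v' \<in> F \<and> (\<forall>w\<in>F. L2_inner M (L2_diff M u v') w = 0)" for v'
    by (rule L2_orthogonal_unique[OF assms(1,2) _ assms(3)]) (use that assms(4) in auto)
qed (use assms in auto)

lemma
  assumes F: "L2_subspace M F" and u: "u \<in> L2 M"
  shows L2_proj_in: "L2_proj M F u \<in> F"
    and L2_proj_orthogonal: "w \<in> F \<Longrightarrow> L2_inner M (L2_diff M u (L2_proj M F u)) w = 0"
proof -
  obtain v where v: "v \<in> F" and orth: "\<And>w. w \<in> F \<Longrightarrow> L2_inner M (L2_diff M u v) w = 0"
    using L2_subspace_nearest_point[OF F u] L2_nearest_point_orthogonal[OF F u] by metis
  then have "L2_proj M F u = v"
    by (rule L2_proj_eqI[OF F u])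
  with v orth show "L2_proj M F u \<in> F" "w \<in> F \<Longrightarrow> L2_inner M (L2_diff M u (L2_proj M F u)) w = 0"
    by simp_all
qed

lemma L2_proj_in_L2:
  assumes "L2_subspace M F" "u \<in> L2 M"
  shows "L2_proj M F u \<in> L2 M"
  using L2_proj_in[OF assms] assms by (auto simp: L2_subspace_def)

lemma L2_proj_fixes:
  assumes F: "L2_subspace M F" and u: "u \<in> F"
  shows "L2_proj M F u = u"
proof (rule L2_proj_eqI[OF F _ u])
  show "u \<in> L2 M"
    using assms by (auto simp: L2_subspace_def)
  then show "L2_inner M (L2_diff M u u) w = 0" if "w \<in> F" for w
    using F that by (subst L2_inner_diff_left) (auto simp: L2_subspace_def)
qed

lemma L2_proj_add:
  assumes F: "L2_subspace M F" and u: "u \<in> L2 M" and v: "v \<in> L2 M"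
  shows "L2_proj M F (L2_add M u v) = L2_add M (L2_proj M F u) (L2_proj M F v)"
proof (rule L2_proj_eqI[OF F])
  note P = L2_proj_in_L2[OF F u] L2_proj_in_L2[OF F v]
  show "L2_add M u v \<in> L2 M"
    using u v by (rule L2_closed)
  show "L2_add M (L2_proj M F u) (L2_proj M F v) \<in> F"
    using L2_proj_in[OF F u] L2_proj_in[OF F v] F by (auto simp: L2_subspace_def)
  fix w assume w: "w \<in> F"
  then have "w \<in> L2 M"
    using F by (auto simp: L2_subspace_def)
  then show "L2_inner M (L2_diff M (L2_add M u v) (L2_add M (L2_proj M F u) (L2_proj M F v))) w = 0"
    using L2_proj_orthogonal[OF F u w] L2_proj_orthogonal[OF F v w] u v P
    by (simp add: L2_inner_diff_left L2_inner_add_left L2_closed)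
qed

lemma L2_proj_scale:
  assumes F: "L2_subspace M F" and u: "u \<in> L2 M"
  shows "L2_proj M F (L2_scale M c u) = L2_scale M c (L2_proj M F u)"
proof (rule L2_proj_eqI[OF F])
  note P = L2_proj_in_L2[OF F u]
  show "L2_scale M c u \<in> L2 M"
    using u by (rule L2_closed)
  show "L2_scale M c (L2_proj M F u) \<in> F"
    using L2_proj_in[OF F u] F by (auto simp: L2_subspace_def)
  fix w assume w: "w \<in> F"
  then have "w \<in> L2 M"
    using F by (auto simp: L2_subspace_def)
  then show "L2_inner M (L2_diff M (L2_scale M c u) (L2_scale M c (L2_proj M F u))) w = 0"
    using L2_proj_orthogonal[OF F u w] u P
    by (simp add: L2_inner_diff_left L2_inner_scale_left L2_closed)
qed

lemma L2_proj_Pythagoras: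
  assumes F: "L2_subspace M F" and u: "u \<in> L2 M"
  shows "(L2_norm M u)\<^sup>2 = (L2_norm M (L2_proj M F u))\<^sup>2 + (L2_norm M (L2_diff M u (L2_proj M F u)))\<^sup>2"
proof -
  note P = L2_proj_in_L2[OF F u]
  have "L2_inner M u (L2_proj M F u) = L2_inner M (L2_proj M F u) (L2_proj M F u)"
    using L2_proj_orthogonal[OF F u L2_proj_in[OF F u]] u P by (simp add: L2_inner_diff_left)
  then show ?thesis
    using u P by (simp add: L2_norm_diff_square L2_inner_self)
qed

lemma L2_proj_norm_le:
  assumes F: "L2_subspace M F" and u: "u \<in> L2 M"
  shows "L2_norm M (L2_proj M F u) \<le> L2_norm M u"
  by (rule power2_le_imp_le) (simp_all add: L2_proj_Pythagoras[OF F u] L2_norm_nonneg u)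

text \<open>The difference of \<open>v\<close> and the projection lies in \<open>F\<close>, hence is
  orthogonal to the residual of \<open>u\<close>, and Pythagoras splits the distance from
  \<open>u\<close> to \<open>v\<close>.\<close>

lemma L2_proj_nearest:
  assumes F: "L2_subspace M F" and u: "u \<in> L2 M" and v: "v \<in> F"
  shows "L2_norm M (L2_diff M u (L2_proj M F u)) \<le> L2_norm M (L2_diff M u v)"
proof -
  let ?p = "L2_proj M F u"
  note p = L2_proj_in[OF F u]
  have L2: "v \<in> L2 M" "?p \<in> L2 M"
    using F v p by (auto simp: L2_subspace_def)
  have "L2_inner M (L2_diff M u ?p) (L2_diff M v ?p) = 0"
    using F u by (rule L2_proj_orthogonal) (rule L2_subspace_diff[OF F v p])
  then have "(L2_norm M (L2_diff M u v))\<^sup>2 =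
      (L2_norm M (L2_diff M u ?p))\<^sup>2 + (L2_norm M (L2_diff M v ?p))\<^sup>2"
    using L2_norm_diff_square[of "L2_diff M u ?p" M "L2_diff M v ?p"] u L2
    by (simp add: L2_closed L2_diff_diff)
  then show ?thesis
    using u L2 by (intro power2_le_imp_le[OF _ L2_norm_nonneg]) (simp_all add: L2_closed)
qed

lemma L2_norm_diff_self: "u \<in> L2 M \<Longrightarrow> L2_norm M (L2_diff M u u) = 0"
  by (subst L2_norm_diff_eq_0) auto

section \<open>Linear operators\<close>

text \<open>The algebraic clauses of \<open>L2_bounded_op\<close> alone; norm bounds are carried
  separately with explicit constants.\<close>

definition L2_linear :: "'b measure \<Rightarrow> 'b L2_op \<Rightarrow> bool" where
  "L2_linear M T \<longleftrightarrow> (\<forall>u\<in>L2 M. T u \<in> L2 M) \<and>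
     (\<forall>u\<in>L2 M. \<forall>v\<in>L2 M. T (L2_add M u v) = L2_add M (T u) (T v)) \<and>
     (\<forall>c. \<forall>u\<in>L2 M. T (L2_scale M c u) = L2_scale M c (T u))"

lemma L2_linearI:
  assumes "\<And>u. u \<in> L2 M \<Longrightarrow> T u \<in> L2 M"
    and "\<And>u v. u \<in> L2 M \<Longrightarrow> v \<in> L2 M \<Longrightarrow> T (L2_add M u v) = L2_add M (T u) (T v)"
    and "\<And>c u. u \<in> L2 M \<Longrightarrow> T (L2_scale M c u) = L2_scale M c (T u)"
  shows "L2_linear M T"
  using assms by (simp add: L2_linear_def)

lemma L2_linearD:
  assumes "L2_linear M T" "u \<in> L2 M"
  shows "T u \<in> L2 M"
    and "v \<in> L2 M \<Longrightarrow> T (L2_add M u v) = L2_add M (T u) (T v)"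
    and "T (L2_scale M c u) = L2_scale M c (T u)"
  using assms by (simp_all add: L2_linear_def)

lemma L2_linear_diff:
  assumes "L2_linear M T" "u \<in> L2 M" "v \<in> L2 M"
  shows "T (L2_diff M u v) = L2_diff M (T u) (T v)"
  using assms by (simp add: L2_diff_eq_add_scale L2_linearD L2_closed)

lemma L2_add_diff_swap:
  assumes "a \<in> L2 M" "b \<in> L2 M" "c \<in> L2 M" "d \<in> L2 M"
  shows "L2_diff M (L2_add M a b) (L2_add M c d) = L2_add M (L2_diff M a c) (L2_diff M b d)"
  using assms by (elim L2_cases) (simp add: L2_class_simps algebra_simps)

lemma L2_scale_diff:
  assumes "a \<in> L2 M" "b \<in> L2 M"
  shows "L2_scale M c (L2_diff M a b) = L2_diff M (L2_scale M c a) (L2_scale M c b)"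
  using assms by (elim L2_cases) (simp add: L2_class_simps algebra_simps)

lemma L2_linear_diff_op:
  assumes "L2_linear M S" "L2_linear M T"
  shows "L2_linear M (\<lambda>u. L2_diff M (S u) (T u))"
  by (rule L2_linearI)
    (simp_all add: L2_linearD[OF assms(1)] L2_linearD[OF assms(2)] L2_closed L2_add_diff_swap
      L2_scale_diff)

lemma L2_linear_scale_op: "L2_linear M (L2_scale M c)"
proof (rule L2_linearI)
  fix u v d assume u: "u \<in> L2 M"
  show "L2_scale M c u \<in> L2 M"
    using u by (rule L2_closed)
  show "L2_scale M c (L2_scale M d u) = L2_scale M d (L2_scale M c u)"
    using u by (elim L2_cases) (simp add: L2_class_simps mult_ac)
  assume "v \<in> L2 M"
  with u show "L2_scale M c (L2_add M u v) = L2_add M (L2_scale M c u) (L2_scale M c v)"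
    by (elim L2_cases) (simp add: L2_class_simps distrib_left)
qed

lemma L2_linear_id: "L2_linear M id"
  by (simp add: L2_linear_def)

lemma L2_linear_comp: "L2_linear M S \<Longrightarrow> L2_linear M T \<Longrightarrow> L2_linear M (S \<circ> T)"
  by (simp add: L2_linear_def)

lemma L2_linear_proj: "L2_subspace M F \<Longrightarrow> L2_linear M (L2_proj M F)"
  by (simp add: L2_linear_def L2_proj_in_L2 L2_proj_add L2_proj_scale)

lemma L2_proj_nonexpansive:
  assumes F: "L2_subspace M F" and u: "u \<in> L2 M" and v: "v \<in> L2 M"
  shows "L2_norm M (L2_diff M (L2_proj M F u) (L2_proj M F v)) \<le> L2_norm M (L2_diff M u v)"
  using L2_proj_norm_le[OF F, of "L2_diff M u v"] u v
  by (simp add: L2_linear_diff[OF L2_linear_proj[OF F]] L2_closed)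

lemma (in finite_measure) L2_linear_mean_op: "L2_linear M (mean_op M)"
proof (rule L2_linearI)
  have int: "integrable M f" if "f \<in> square_integrable M" for f :: "'a \<Rightarrow> complex"
    using integrable_square_integrable_mult[OF that square_integrable_const[of 1]] by simp
  fix u v c assume u: "u \<in> L2 M"
  show "mean_op M u \<in> L2 M"
    using u by (elim L2_cases) (simp add: L2_class_simps square_integrable_const)
  show "mean_op M (L2_scale M c u) = L2_scale M c (mean_op M u)"
    using u by (elim L2_cases) (simp add: L2_class_simps square_integrable_const)
  assume "v \<in> L2 M"
  with u show "mean_op M (L2_add M u v) = L2_add M (mean_op M u) (mean_op M v)"
    by (elim L2_cases) (simp add: L2_class_simps square_integrable_const int)
qed

text \<open>Exchanging the chosen representatives costs one null set per index, and a finite union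
  of null sets is null.\<close>

lemma L2_class_sum_rep:
  assumes "finite I" "\<And>i. i \<in> I \<Longrightarrow> f i \<in> square_integrable M"
  shows "L2_class M (\<lambda>x. \<Sum>i\<in>I. c i * L2_rep (L2_class M (f i)) x) =
    L2_class M (\<lambda>x. \<Sum>i\<in>I. c i * f i x)"
proof (rule L2_class_eqI)
  have "AE x in M. \<forall>i\<in>I. L2_rep (L2_class M (f i)) x = f i x"
    using assms L2_rep_class by (intro AE_finite_allI) auto
  then show "AE x in M. (\<Sum>i\<in>I. c i * L2_rep (L2_class M (f i)) x) = (\<Sum>i\<in>I. c i * f i x)"
    by eventually_elim (rule sum.cong, auto)
qed

lemma square_integrable_sum_rep:
  assumes "\<And>i. i \<in> I \<Longrightarrow> a i \<in> L2 M"
  shows "(\<lambda>x. \<Sum>i\<in>I. c i * L2_rep (a i) x) \<in> square_integrable M"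
  using assms by (intro square_integrable_sum square_integrable_scale L2_rep_square_integrable)

text \<open>\<open>L2_rep\<close> involves a choice and need not be additive. Linearity appears once
  each summand is rewritten as the class of an explicit function, so that
  \<open>L2_class_sum_rep\<close> removes the choice.\<close>

lemma L2_linear_sum_op:
  assumes I: "finite I" and T: "\<And>i. i \<in> I \<Longrightarrow> L2_linear M (T i)"
  shows "L2_linear M (\<lambda>u. L2_class M (\<lambda>x. \<Sum>i\<in>I. c i * L2_rep (T i u) x))"
proof (rule L2_linearI)
  fix u v b assume u: "u \<in> L2 M"
  have sq: "L2_rep (T i w) \<in> square_integrable M" if "i \<in> I" "w \<in> L2 M" for i w
    using L2_linearD(1)[OF T] that by (blast intro: L2_rep_square_integrable)
  have sum: "(\<lambda>x. \<Sum>i\<in>I. c i * L2_rep (T i w) x) \<in> square_integrable M" if "w \<in> L2 M" for w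
    using that by (intro square_integrable_sum_rep L2_linearD(1)[OF T])
  have scale: "T i (L2_scale M b u) = L2_class M (\<lambda>x. b * L2_rep (T i u) x)" if "i \<in> I" for i
    unfolding L2_linearD(3)[OF T[OF that] u] by (rule L2_scale_def)
  show "L2_class M (\<lambda>x. \<Sum>i\<in>I. c i * L2_rep (T i u) x) \<in> L2 M"
    using sum[OF u] by (rule L2_class_in_L2)
  have "L2_class M (\<lambda>x. \<Sum>i\<in>I. c i * L2_rep (T i (L2_scale M b u)) x) =
      L2_class M (\<lambda>x. \<Sum>i\<in>I. c i * L2_rep (L2_class M (\<lambda>x. b * L2_rep (T i u) x)) x)"
    by (simp add: scale cong: sum.cong)
  also have "\<dots> = L2_class M (\<lambda>x. b * (\<Sum>i\<in>I. c i * L2_rep (T i u) x))"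
    using u by (subst L2_class_sum_rep)
      (auto simp: I sq sum_distrib_left mult_ac intro: square_integrable_scale)
  finally show "L2_class M (\<lambda>x. \<Sum>i\<in>I. c i * L2_rep (T i (L2_scale M b u)) x) =
      L2_scale M b (L2_class M (\<lambda>x. \<Sum>i\<in>I. c i * L2_rep (T i u) x))"
    using u by (simp add: L2_scale_class sum)
  assume v: "v \<in> L2 M"
  have add: "T i (L2_add M u v) = L2_class M (\<lambda>x. L2_rep (T i u) x + L2_rep (T i v) x)"
    if "i \<in> I" for i
    unfolding L2_linearD(2)[OF T[OF that] u v] by (rule L2_add_def)
  have "L2_class M (\<lambda>x. \<Sum>i\<in>I. c i * L2_rep (T i (L2_add M u v)) x) =
      L2_class M (\<lambda>x. \<Sum>i\<in>I. c i * L2_rep (L2_class M (\<lambda>x. L2_rep (T i u) x + L2_rep (T i v) x)) x)"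
    by (simp add: add cong: sum.cong)
  also have "\<dots> = L2_class M (\<lambda>x. (\<Sum>i\<in>I. c i * L2_rep (T i u) x) + (\<Sum>i\<in>I. c i * L2_rep (T i v) x))"
    using u v by (subst L2_class_sum_rep)
      (auto simp: I sq sum.distrib distrib_left intro: square_integrable_add)
  finally show "L2_class M (\<lambda>x. \<Sum>i\<in>I. c i * L2_rep (T i (L2_add M u v)) x) =
      L2_add M (L2_class M (\<lambda>x. \<Sum>i\<in>I. c i * L2_rep (T i u) x))
        (L2_class M (\<lambda>x. \<Sum>i\<in>I. c i * L2_rep (T i v) x))"
    using u v by (simp add: L2_add_class sum)
qed

lemma L2_norm_add_le:
  assumes "u \<in> L2 M" "v \<in> L2 M"
  shows "L2_norm M (L2_add M u v) \<le> L2_norm M u + L2_norm M v"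
proof -
  have "L2_add M u v = L2_diff M u (L2_scale M (-1) v)"
    using assms
    by (elim L2_cases)
      (simp only: L2_scale_class L2_diff_class L2_add_class square_integrable_scale, simp)
  then show ?thesis
    using L2_norm_diff_le[of u M "L2_scale M (-1) v"] assms by (simp add: L2_closed L2_norm_scale)
qed

text \<open>The triangle inequality in the shape in which mixtures are defined, with the sum taken
  on representatives.\<close>

lemma L2_norm_sum_le:
  assumes "finite I" "\<And>i. i \<in> I \<Longrightarrow> a i \<in> L2 M"
  shows "L2_norm M (L2_class M (\<lambda>x. \<Sum>i\<in>I. c i * L2_rep (a i) x)) \<le> (\<Sum>i\<in>I. cmod (c i) * L2_norm M (a i))"
  using assms
proof (induction I)
  case empty
  then show ?case
    by (simp add: L2_norm_class square_integrable_zero)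
next
  case (insert i I)
  let ?s = "\<lambda>x. \<Sum>i\<in>I. c i * L2_rep (a i) x"
  have s: "?s \<in> square_integrable M"
    using insert.prems by (intro square_integrable_sum_rep) auto
  have "L2_class M (\<lambda>x. \<Sum>i\<in>insert i I. c i * L2_rep (a i) x) =
      L2_add M (L2_scale M (c i) (a i)) (L2_class M ?s)"
    using insert s
    by (simp add: L2_scale_def L2_add_class square_integrable_scale L2_rep_square_integrable)
  also have "L2_norm M \<dots> \<le> L2_norm M (L2_scale M (c i) (a i)) + L2_norm M (L2_class M ?s)"
    using insert.prems s by (intro L2_norm_add_le L2_closed L2_class_in_L2) auto
  also have "\<dots> \<le> cmod (c i) * L2_norm M (a i) + (\<Sum>i\<in>I. cmod (c i) * L2_norm M (a i))"
    using insert by (simp add: L2_norm_scale)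
  finally show ?case
    using insert.hyps by simp
qed

lemma L2_norm_le_diff:
  assumes "u \<in> L2 M" "v \<in> L2 M"
  shows "L2_norm M u \<le> L2_norm M (L2_diff M u v) + L2_norm M v"
proof -
  have "u = L2_add M (L2_diff M u v) v"
    using assms by (elim L2_cases) (simp add: L2_class_simps)
  then show ?thesis
    using L2_norm_add_le[of "L2_diff M u v" M v] assms by (simp add: L2_closed)
qed

section \<open>Spectral radius and spectral gap\<close>

context finite_measure
begin

text \<open>The equation \<open>l v - T v = u\<close> is the fixed-point equation
  \<open>v = (u + T v) / l\<close>, whose right-hand side contracts with factor
  \<open>q / cmod l\<close>.\<close>

lemma L2_resolvent_surj:
  assumes T: "L2_linear M T" and q: "\<And>u. u \<in> L2 M \<Longrightarrow> L2_norm M (T u) \<le> q * L2_norm M u"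
    and l: "q < cmod l" "0 \<le> q" and u: "u \<in> L2 M"
  shows "\<exists>v\<in>L2 M. L2_diff M (L2_scale M l v) (T v) = u"
proof -
  interpret Metric_space "L2 M" "L2_dist M"
    by (rule Metric_space_L2_dist) simp
  have l0: "l \<noteq> 0"
    using l by auto
  define b where "b = 1 / l"
  have b: "l * b = 1" "cmod b = 1 / cmod l"
    using l0 by (simp_all add: b_def norm_divide)
  define \<Phi> where "\<Phi> v = L2_scale M b (L2_add M u (T v))" for v
  have \<Phi>: "\<Phi> v \<in> L2 M" if "v \<in> L2 M" for v
    using u L2_linearD(1)[OF T that] unfolding \<Phi>_def by (intro L2_closed)
  have "L2_dist M (\<Phi> v) (\<Phi> w) \<le> q / cmod l * L2_dist M v w" if "v \<in> L2 M" "w \<in> L2 M" for v w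
  proof -
    have "L2_diff M (\<Phi> v) (\<Phi> w) = L2_scale M b (L2_diff M (T v) (T w))"
      using u L2_linearD(1)[OF T that(1)] L2_linearD(1)[OF T that(2)] unfolding \<Phi>_def
      by (elim L2_cases) (simp add: L2_class_simps, simp add: algebra_simps)
    also have "\<dots> = L2_scale M b (T (L2_diff M v w))"
      using that by (simp add: L2_linear_diff[OF T])
    finally have "L2_dist M (\<Phi> v) (\<Phi> w) = L2_norm M (T (L2_diff M v w)) / cmod l"
      using that by (simp add: \<Phi>  L2_dist_def L2_norm_scale L2_linearD[OF T] L2_closed b)
    also have "\<dots> \<le> q * L2_norm M (L2_diff M v w) / cmod l"
      using q[of "L2_diff M v w"] that by (simp add: L2_closed divide_right_mono)
    finally show ?thesis
      using that by (simp add: L2_dist_def)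
  qed
  moreover have "q / cmod l < 1"
    using l l0 by (simp add: divide_less_eq)
  ultimately obtain v where v: "v \<in> L2 M" "\<Phi> v = v"
    using Banach_fixedpoint_thm[OF mcomplete_L2, of \<Phi> "q / cmod l"] u \<Phi> by blast
  have "L2_diff M (L2_scale M l (\<Phi> v)) (T v) = u"
    using u L2_linearD(1)[OF T v(1)] unfolding \<Phi>_def
    by (elim L2_cases) (simp add: L2_class_simps, simp add: mult.assoc[symmetric] b)
  then show ?thesis
    using v by auto
qed

text \<open>For \<open>cmod l > q\<close> the operator \<open>l - T\<close> expands norms by at
  least \<open>cmod l - q\<close>, which gives injectivity and bounds the inverse; surjectivity is
  the fixed-point lemma.\<close>

lemma L2_spectral_radius_le:
  assumes T: "L2_linear M T" and q: "\<And>u. u \<in> L2 M \<Longrightarrow> L2_norm M (T u) \<le> q * L2_norm M u"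
    and q0: "0 \<le> q"
  shows "L2_spectral_radius M T \<le> ennreal q"
  unfolding L2_spectral_radius_def
proof (rule SUP_least)
  fix l assume l: "l \<in> L2_spectrum M T"
  show "ennreal (cmod l) \<le> ennreal q"
  proof (rule ccontr)
    assume "\<not> ennreal (cmod l) \<le> ennreal q"
    then have less: "q < cmod l"
      using ennreal_leI not_le by blast
    define A where "A = (\<lambda>u. L2_diff M (L2_scale M l u) (T u))"
    have A: "L2_linear M A"
      unfolding A_def by (intro L2_linear_diff_op L2_linear_scale_op T)
    have lower: "(cmod l - q) * L2_norm M u \<le> L2_norm M (A u)" if "u \<in> L2 M" for u
      using L2_norm_le_diff[of "L2_scale M l u" M "T u"] q[OF that] that
      by (simp add: A_def L2_norm_scale L2_closed L2_linearD[OF T] left_diff_distrib)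
    have inj: "v = w" if "v \<in> L2 M" "w \<in> L2 M" "A v = A w" for v w
    proof -
      have "L2_norm M (A (L2_diff M v w)) = 0"
        using that by (simp add: L2_linear_diff[OF A] L2_linearD[OF A] L2_norm_diff_eq_0)
      then have "(cmod l - q) * L2_norm M (L2_diff M v w) \<le> 0"
        using lower[of "L2_diff M v w"] that by (simp add: L2_closed)
      then have "L2_norm M (L2_diff M v w) \<le> 0"
        using less by (simp add: mult_le_0_iff)
      then show ?thesis
        using L2_norm_nonneg[of "L2_diff M v w" M] that
        by (simp add: L2_closed L2_norm_diff_eq_0[symmetric])
    qed
    \<comment> \<open>A choice of preimages; injectivity of \<open>A\<close> makes it linear and a
      left inverse as well.\<close>
    define S where "S u = (SOME v. v \<in> L2 M \<and> A v = u)" for u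
    have S: "S u \<in> L2 M" "A (S u) = u" if "u \<in> L2 M" for u
    proof -
      have "\<exists>v. v \<in> L2 M \<and> A v = u"
        using L2_resolvent_surj[OF T q less q0 that] by (auto simp: A_def)
      then have "S u \<in> L2 M \<and> A (S u) = u"
        unfolding S_def by (rule someI_ex)
      then show "S u \<in> L2 M" "A (S u) = u"
        by auto
    qed
    have "L2_bounded_op M S"
      unfolding L2_bounded_op_def
    proof (intro conjI ballI allI exI)
      fix u v c assume u: "u \<in> L2 M"
      show "S u \<in> L2 M"
        using u by (rule S)
      show "S (L2_scale M c u) = L2_scale M c (S u)"
        by (rule inj) (simp_all add: u S L2_closed L2_linearD[OF A])
      have "(cmod l - q) * L2_norm M (S u) \<le> L2_norm M u"
        using lower[of "S u"] u by (simp add: S)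
      then show "L2_norm M (S u) \<le> (1 / (cmod l - q)) * L2_norm M u"
        using less by (simp add: field_simps)
      assume v: "v \<in> L2 M"
      show "S (L2_add M u v) = L2_add M (S u) (S v)"
        by (rule inj) (simp_all add: u v S L2_closed L2_linearD[OF A])
    qed
    moreover have "S (A u) = u" if "u \<in> L2 M" for u
      by (rule inj) (simp_all add: that S L2_linearD[OF A])
    ultimately have "l \<notin> L2_spectrum M T"
      using S(2) by (auto simp: L2_spectrum_def A_def)
    with l show False
      by simp
  qed
qed

end

section \<open>Mean-zero vectors and the spectral gap\<close>

definition L2_zero :: "'b measure \<Rightarrow> ('b \<Rightarrow> complex) set" where
  "L2_zero M = L2_class M (\<lambda>_. 0)"

context prob_space
begin

text \<open>On a probability space the mean is an orthogonal projection, so subtracting it removes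
  \<open>(cmod m)\<^sup>2\<close> from the squared norm.\<close>

lemma L2_norm_diff_mean_le:
  assumes "u \<in> L2 M"
  shows "L2_norm M (L2_diff M u (mean_op M u)) \<le> L2_norm M u"
  using assms
proof (elim L2_cases)
  fix f assume f: "f \<in> square_integrable M" and u_eq: "u = L2_class M f"
  define m where "m = (\<integral>x. f x \<partial>M)"
  have mean: "mean_op M (L2_class M f) = L2_class M (\<lambda>_. m)"
    by (simp add: m_def mean_op_class f)
  have "L2_inner M u (mean_op M u) = complex_of_real ((cmod m)\<^sup>2)"
    using f integrable_square_integrable_mult[OF f square_integrable_const[of 1]]
    by (simp add: mean u_eq L2_inner_class square_integrable_const m_def[symmetric] complex_norm_square
        del: of_real_power)
  moreover have "(L2_norm M (mean_op M u))\<^sup>2 = (cmod m)\<^sup>2"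
    by (simp add: u_eq mean L2_norm_class square_integrable_const prob_space)
  ultimately have "(L2_norm M (L2_diff M u (mean_op M u)))\<^sup>2 = (L2_norm M u)\<^sup>2 - (cmod m)\<^sup>2"
    using assms by (simp add: L2_norm_diff_square L2_linearD[OF L2_linear_mean_op])
  then show ?thesis
    using assms by (intro power2_le_imp_le[OF _ L2_norm_nonneg]) simp_all
qed

lemma mean_op_diff_mean:
  assumes "u \<in> L2 M"
  shows "mean_op M (L2_diff M u (mean_op M u)) = L2_zero M"
  using assms
proof (elim L2_cases)
  fix f assume f: "f \<in> square_integrable M" and u_eq: "u = L2_class M f"
  then show ?thesis
    using integrable_square_integrable_mult[OF f square_integrable_const[of 1]]
    by (simp add: L2_class_simps square_integrable_const L2_zero_def prob_space)
qed

text \<open>Since \<open>Q\<close> fixes constants, \<open>Q u - \<Pi> u = Q (u - \<Pi> u)\<close>,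
  and a contraction on mean-zero vectors bounds \<open>Q - \<Pi>\<close> on the whole space.\<close>

lemma has_spectral_gapI:
  assumes Q: "L2_linear M Q" and const: "\<And>c. Q (L2_class M (\<lambda>_. c)) = L2_class M (\<lambda>_. c)"
    and q: "0 \<le> q" "q < 1"
    and contr: "\<And>u. u \<in> L2 M \<Longrightarrow> mean_op M u = L2_zero M \<Longrightarrow> L2_norm M (Q u) \<le> q * L2_norm M u"
  shows "has_spectral_gap M Q"
proof -
  let ?T = "\<lambda>u. L2_diff M (Q u) (mean_op M u)"
  have "L2_norm M (?T u) \<le> q * L2_norm M u" if u: "u \<in> L2 M" for u
  proof -
    note mean = L2_linearD(1)[OF L2_linear_mean_op u]
    have "Q (mean_op M u) = mean_op M u"
      by (simp add: mean_op_def const)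
    then have "?T u = Q (L2_diff M u (mean_op M u))"
      by (simp add: L2_linear_diff[OF Q u mean])
    also have "L2_norm M \<dots> \<le> q * L2_norm M (L2_diff M u (mean_op M u))"
      using u mean by (intro contr L2_closed mean_op_diff_mean)
    also have "\<dots> \<le> q * L2_norm M u"
      using q L2_norm_diff_mean_le[OF u] by (simp add: mult_left_mono)
    finally show ?thesis .
  qed
  then have "L2_spectral_radius M ?T \<le> ennreal q"
    using q by (intro L2_spectral_radius_le L2_linear_diff_op Q L2_linear_mean_op)
  also have "\<dots> < 1"
    using q by (simp add: ennreal_less_one_iff)
  finally show ?thesis
    by (simp add: has_spectral_gap_def)
qed

lemma has_spectral_gap_lower_bound:
  assumes gap: "has_spectral_gap M Q" and Q: "\<And>u. u \<in> L2 M \<Longrightarrow> Q u \<in> L2 M"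
  obtains B where "B > 0"
    "\<And>u. u \<in> L2 M \<Longrightarrow> mean_op M u = L2_zero M \<Longrightarrow> L2_norm M u \<le> B * L2_norm M (L2_diff M u (Q u))"
proof -
  let ?T = "\<lambda>u. L2_diff M (Q u) (mean_op M u)"
  have "1 \<notin> L2_spectrum M ?T"
  proof
    assume "1 \<in> L2_spectrum M ?T"
    then have "ennreal (cmod 1) \<le> L2_spectral_radius M ?T"
      unfolding L2_spectral_radius_def by (rule SUP_upper)
    then show False
      using gap by (simp add: has_spectral_gap_def)
  qed
  then obtain S where "L2_bounded_op M S"
    and inv: "\<And>u. u \<in> L2 M \<Longrightarrow> S (L2_diff M (L2_scale M 1 u) (?T u)) = u"
    by (auto simp: L2_spectrum_def)
  then obtain B where B: "\<forall>u\<in>L2 M. L2_norm M (S u) \<le> B * L2_norm M u"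
    unfolding L2_bounded_op_def by blast
  \<comment> \<open>The constant supplied by \<open>L2_bounded_op\<close> may be zero or negative,
    hence the maximum with \<open>1\<close>.\<close>
  have "L2_norm M u \<le> max B 1 * L2_norm M (L2_diff M u (Q u))"
    if u: "u \<in> L2 M" and mean: "mean_op M u = L2_zero M" for u
  proof -
    have "L2_diff M (L2_scale M 1 u) (?T u) = L2_diff M u (Q u)"
      using u Q[OF u] unfolding mean L2_zero_def
      by (elim L2_cases) (simp add: L2_class_simps square_integrable_zero)
    then have "L2_norm M u \<le> B * L2_norm M (L2_diff M u (Q u))"
      using bspec[OF B, of "L2_diff M u (Q u)"] inv[OF u] u Q[OF u] by (simp add: L2_closed)
    also have "\<dots> \<le> max B 1 * L2_norm M (L2_diff M u (Q u))"
      using u Q[OF u] by (intro mult_right_mono L2_norm_nonneg L2_closed) auto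
    finally show ?thesis .
  qed
  then show thesis
    by (intro that[of "max B 1"]) auto
qed

end

section \<open>Coercive collections of subspaces\<close>

text \<open>The quantifier over \<open>v\<close> expresses the distance to \<open>F\<close> without
  an infimum or a projection; \<open>F\<close> may depend on \<open>u\<close>, but \<open>c\<close>
  may not.\<close>

definition L2_coercive :: "'b measure \<Rightarrow> ('b \<Rightarrow> complex) set set set \<Rightarrow> bool" where
  "L2_coercive M \<F> \<longleftrightarrow> (\<exists>c>0. \<forall>u\<in>L2 M. mean_op M u = L2_zero M \<longrightarrow>
     (\<exists>F\<in>\<F>. \<forall>v\<in>F. c * L2_norm M u \<le> L2_norm M (L2_diff M u v)))"

lemma L2_coercive_mono:
  assumes "L2_coercive M \<F>" "\<And>F. F \<in> \<F> \<Longrightarrow> \<exists>G\<in>\<G>. G \<subseteq> F"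
  shows "L2_coercive M \<G>"
  using assms unfolding L2_coercive_def by (meson subsetD)

text \<open>Tested on the zero vector, which has mean zero. This is what later makes the length of a
  coercive cycle at least \<open>1\<close>.\<close>

lemma L2_coercive_nonempty:
  assumes "L2_coercive M \<F>"
  shows "\<F> \<noteq> {}"
proof -
  have "L2_zero M \<in> L2 M" "mean_op M (L2_zero M) = L2_zero M"
    by (simp_all add: L2_zero_def L2_class_in_L2 mean_op_class square_integrable_zero)
  then show ?thesis
    using assms unfolding L2_coercive_def by blast
qed

text \<open>The contrapositive form, matched to what a gap delivers: being near all subspaces forces
  a small norm.\<close>

lemma L2_coerciveI:
  assumes ne: "\<F> \<noteq> {}" and sub: "\<And>F. F \<in> \<F> \<Longrightarrow> F \<subseteq> L2 M" and B: "B > 0"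
    and bound: "\<And>u e. \<lbrakk>u \<in> L2 M; mean_op M u = L2_zero M;
        \<And>F. F \<in> \<F> \<Longrightarrow> \<exists>v\<in>F. L2_norm M (L2_diff M u v) \<le> e\<rbrakk> \<Longrightarrow> L2_norm M u \<le> B * e"
  shows "L2_coercive M \<F>"
  unfolding L2_coercive_def
\<comment> \<open>The factor \<open>2\<close> turns a failure at \<open>u\<close> into
  \<open>L2_norm M u \<le> L2_norm M u / 2\<close>.\<close>
proof (intro exI[of _ "1 / (2 * B)"] conjI ballI impI)
  show "0 < 1 / (2 * B)"
    using B by simp
  fix u assume u: "u \<in> L2 M" "mean_op M u = L2_zero M"
  show "\<exists>F\<in>\<F>. \<forall>v\<in>F. 1 / (2 * B) * L2_norm M u \<le> L2_norm M (L2_diff M u v)"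
  proof (rule ccontr)
    assume "\<not> ?thesis"
    then have less: "\<exists>v\<in>F. L2_norm M (L2_diff M u v) < 1 / (2 * B) * L2_norm M u" if "F \<in> \<F>" for F
      using that by (force simp: not_le)
    \<comment> \<open>Nonemptiness of \<open>\<F>\<close> supplies a strict inequality above a norm,
      which excludes \<open>L2_norm M u = 0\<close>.\<close>
    obtain F v where "F \<in> \<F>" "v \<in> F" and v: "L2_norm M (L2_diff M u v) < 1 / (2 * B) * L2_norm M u"
      using ne less by blast
    then have "0 \<le> L2_norm M (L2_diff M u v)"
      using sub u by (blast intro: L2_norm_nonneg L2_closed)
    with v have "0 < 1 / (2 * B) * L2_norm M u"
      by linarith
    then have pos: "0 < L2_norm M u"
      by (rule zero_less_mult_pos) (use B in simp)
    have "L2_norm M u \<le> B * (1 / (2 * B) * L2_norm M u)"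
      using less by (intro bound u) (meson less_imp_le)
    with B pos show False
      by simp
  qed
qed

text \<open>A constant at most \<open>1\<close> keeps the later radicands such as
  \<open>1 - c\<^sup>2\<close> nonnegative.\<close>

lemma L2_coercive_le_1:
  assumes "L2_coercive M \<F>"
  obtains c where "0 < c" "c \<le> 1" and
    "\<And>u. \<lbrakk>u \<in> L2 M; mean_op M u = L2_zero M\<rbrakk> \<Longrightarrow>
      \<exists>F\<in>\<F>. \<forall>v\<in>F. c * L2_norm M u \<le> L2_norm M (L2_diff M u v)"
proof -
  obtain c where c: "c > 0" and
    bound: "\<And>u. \<lbrakk>u \<in> L2 M; mean_op M u = L2_zero M\<rbrakk> \<Longrightarrow>
      \<exists>F\<in>\<F>. \<forall>v\<in>F. c * L2_norm M u \<le> L2_norm M (L2_diff M u v)"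
    using assms unfolding L2_coercive_def by blast
  have "\<exists>F\<in>\<F>. \<forall>v\<in>F. min c 1 * L2_norm M u \<le> L2_norm M (L2_diff M u v)"
    if "u \<in> L2 M" "mean_op M u = L2_zero M" for u
  proof -
    have "min c 1 * L2_norm M u \<le> c * L2_norm M u"
      using that by (intro mult_right_mono L2_norm_nonneg) auto
    then show ?thesis
      using bound[OF that] by (meson order_trans)
  qed
  with c show thesis
    by (intro that[of "min c 1"]) auto
qed

section \<open>Cycles of projections\<close>

definition L2_cycle :: "'b measure \<Rightarrow> ('b \<Rightarrow> complex) set set list \<Rightarrow> 'b L2_op" where
  "L2_cycle M Fs = foldr (\<circ>) (map (L2_proj M) Fs) id"

lemma L2_cycle_simps [simp]:
  "L2_cycle M [] u = u"
  "L2_cycle M (F # Fs) u = L2_proj M F (L2_cycle M Fs u)"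
  by (simp_all add: L2_cycle_def)

lemma L2_linear_cycle:
  assumes "\<And>F. F \<in> set Fs \<Longrightarrow> L2_subspace M F"
  shows "L2_linear M (L2_cycle M Fs)"
  using assms unfolding L2_cycle_def
  by (induction Fs) (simp_all add: L2_linear_id L2_linear_comp L2_linear_proj)

lemma L2_cycle_fixes:
  assumes "\<And>F. F \<in> set Fs \<Longrightarrow> L2_subspace M F" "\<And>F. F \<in> set Fs \<Longrightarrow> u \<in> F"
  shows "L2_cycle M Fs u = u"
  using assms by (induction Fs) (simp_all add: L2_proj_fixes)

text \<open>With \<open>y\<close> the result of the earlier projections and \<open>P\<close> the
  next one, \<open>u - P y\<close> splits into \<open>u - P u\<close>, of norm at most
  \<open>e\<close>, and \<open>P (u - y)\<close>, no longer than \<open>u - y\<close>. Each subspace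
  adds one \<open>e\<close>.\<close>

lemma L2_norm_diff_cycle_le:
  assumes "\<And>F. F \<in> set Fs \<Longrightarrow> L2_subspace M F" and u: "u \<in> L2 M"
    and "\<And>F. F \<in> set Fs \<Longrightarrow> \<exists>v\<in>F. L2_norm M (L2_diff M u v) \<le> e"
  shows "L2_norm M (L2_diff M u (L2_cycle M Fs u)) \<le> real (length Fs) * e"
  using assms(1,3)
proof (induction Fs)
  case Nil
  then show ?case
    using u by (simp add: L2_norm_diff_self)
next
  case (Cons F Fs)
  let ?y = "L2_cycle M Fs u"
  have F: "L2_subspace M F"
    using Cons.prems by simp
  have y: "?y \<in> L2 M"
    using Cons.prems(1) u by (intro L2_linearD(1)[OF L2_linear_cycle]) auto
  note P = L2_proj_in_L2[OF F]
  obtain v where "v \<in> F" "L2_norm M (L2_diff M u v) \<le> e"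
    using Cons.prems(2)[of F] by auto
  then have "L2_norm M (L2_diff M u (L2_proj M F u)) \<le> e"
    using L2_proj_nearest[OF F u] by (meson order_trans)
  moreover have "L2_norm M (L2_diff M u ?y) \<le> real (length Fs) * e"
    using Cons by simp
  ultimately show ?case
    using L2_norm_triangle[OF u P[OF u] P[OF y]] L2_proj_nonexpansive[OF F u y]
    by (simp add: distrib_right)
qed

text \<open>Either some projection of the cycle moves its argument by at least \<open>\<eta>\<close>, which costs \<open>\<eta>\<^sup>2\<close> in
  Pythagoras' theorem, or the whole orbit stays close to \<open>u\<close>.\<close>

lemma L2_cycle_dichotomy:
  assumes "\<And>F. F \<in> set Fs \<Longrightarrow> L2_subspace M F" and u: "u \<in> L2 M" and \<eta>: "0 \<le> \<eta>"
  shows "(L2_norm M (L2_cycle M Fs u))\<^sup>2 \<le> (L2_norm M u)\<^sup>2 - \<eta>\<^sup>2 \<or>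
    (L2_norm M (L2_cycle M Fs u) \<le> L2_norm M u \<and>
     L2_norm M (L2_diff M u (L2_cycle M Fs u)) \<le> real (length Fs) * \<eta> \<and>
     (\<forall>F\<in>set Fs. \<exists>v\<in>F. L2_norm M (L2_diff M u v) \<le> real (length Fs) * \<eta>))"
  using assms(1)
proof (induction Fs)
  case Nil
  then show ?case
    using u by (simp add: L2_norm_diff_self)
next
  case (Cons F Fs)
  let ?y = "L2_cycle M Fs u"
  have F: "L2_subspace M F"
    using Cons.prems by simp
  have y: "?y \<in> L2 M"
    using Cons.prems u by (intro L2_linearD(1)[OF L2_linear_cycle]) auto
  note p = L2_proj_in[OF F y] L2_proj_in_L2[OF F y]
  have le: "L2_norm M (L2_proj M F ?y) \<le> L2_norm M ?y"
    using F y by (rule L2_proj_norm_le)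
  then have le2: "(L2_norm M (L2_proj M F ?y))\<^sup>2 \<le> (L2_norm M ?y)\<^sup>2"
    using p by (simp add: L2_norm_nonneg power_mono)
  consider "(L2_norm M ?y)\<^sup>2 \<le> (L2_norm M u)\<^sup>2 - \<eta>\<^sup>2"
    | "L2_norm M ?y \<le> L2_norm M u" "L2_norm M (L2_diff M u ?y) \<le> real (length Fs) * \<eta>"
      "\<forall>F\<in>set Fs. \<exists>v\<in>F. L2_norm M (L2_diff M u v) \<le> real (length Fs) * \<eta>"
    using Cons by auto
  then show ?case
  proof cases
    case 1
    then show ?thesis
      using le2 by auto
  next
    case 2
    show ?thesis
    proof (cases "\<eta> \<le> L2_norm M (L2_diff M ?y (L2_proj M F ?y))")
      case True
      then have "\<eta>\<^sup>2 \<le> (L2_norm M (L2_diff M ?y (L2_proj M F ?y)))\<^sup>2"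
        using \<eta> by (simp add: power_mono)
      moreover have "(L2_norm M ?y)\<^sup>2 \<le> (L2_norm M u)\<^sup>2"
        using 2 y by (simp add: L2_norm_nonneg power_mono)
      ultimately show ?thesis
        using L2_proj_Pythagoras[OF F y] by auto
    next
      case False
      then have close: "L2_norm M (L2_diff M u (L2_proj M F ?y)) \<le> real (length (F # Fs)) * \<eta>"
        using 2 L2_norm_triangle[OF u y p(2)] by (simp add: distrib_right)
      have "real (length Fs) * \<eta> \<le> real (length (F # Fs)) * \<eta>"
        using \<eta> by (simp add: mult_right_mono)
      \<comment> \<open>For the new subspace the nearby point is the current iterate
        \<open>L2_proj M F ?y\<close>; the older witnesses remain, with a weaker bound.\<close>
      then have "\<forall>G\<in>set (F # Fs). \<exists>v\<in>G. L2_norm M (L2_diff M u v) \<le> real (length (F # Fs)) * \<eta>"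
        using 2(3) close p(1) by (auto intro: order_trans simp del: length_Cons)
      then show ?thesis
        using close le 2 by (auto simp del: length_Cons)
    qed
  qed
qed

context prob_space
begin

text \<open>A vector within \<open>e\<close> of every subspace is displaced by the cycle by at most
  \<open>length Fs * e\<close>, and the gap converts displacement into norm.\<close>

lemma L2_coercive_if_cycle_gap:
  assumes Fs: "\<And>F. F \<in> set Fs \<Longrightarrow> L2_subspace M F" "Fs \<noteq> []"
    and gap: "has_spectral_gap M (L2_cycle M Fs)"
  shows "L2_coercive M (set Fs)"
proof -
  obtain B where B: "B > 0" and lower:
    "\<And>u. u \<in> L2 M \<Longrightarrow> mean_op M u = L2_zero M \<Longrightarrow>
      L2_norm M u \<le> B * L2_norm M (L2_diff M u (L2_cycle M Fs u))"
    using has_spectral_gap_lower_bound[OF gap L2_linearD(1)[OF L2_linear_cycle[OF Fs(1)]]] by blast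
  show ?thesis
  proof (rule L2_coerciveI)
    show "0 < B * real (length Fs)"
      using B Fs by simp
    fix u e assume u: "u \<in> L2 M" "mean_op M u = L2_zero M"
      and near: "\<And>F. F \<in> set Fs \<Longrightarrow> \<exists>v\<in>F. L2_norm M (L2_diff M u v) \<le> e"
    have "L2_norm M (L2_diff M u (L2_cycle M Fs u)) \<le> real (length Fs) * e"
      using Fs(1) u(1) near by (rule L2_norm_diff_cycle_le)
    then have "B * L2_norm M (L2_diff M u (L2_cycle M Fs u)) \<le> B * (real (length Fs) * e)"
      using B by (intro mult_left_mono) auto
    then show "L2_norm M u \<le> B * real (length Fs) * e"
      using lower[OF u] by (simp add: mult.assoc)
  qed (use Fs in \<open>auto simp: L2_subspace_def\<close>)
qed

lemma cycle_gap_if_L2_coercive: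
  assumes Fs: "\<And>F. F \<in> set Fs \<Longrightarrow> L2_subspace M F"
    and const: "\<And>F c. F \<in> set Fs \<Longrightarrow> L2_class M (\<lambda>_. c) \<in> F"
    and coercive: "L2_coercive M (set Fs)"
  shows "has_spectral_gap M (L2_cycle M Fs)"
proof -
  obtain c where c: "0 < c" "c \<le> 1" and far:
    "\<And>u. \<lbrakk>u \<in> L2 M; mean_op M u = L2_zero M\<rbrakk> \<Longrightarrow>
      \<exists>F\<in>set Fs. \<forall>v\<in>F. c * L2_norm M u \<le> L2_norm M (L2_diff M u v)"
    using L2_coercive_le_1[OF coercive] by blast
  define n where "n = real (length Fs)"
  have n: "n \<ge> 1"
    using L2_coercive_nonempty[OF coercive] by (cases Fs) (auto simp: n_def)
  \<comment> \<open>With \<open>\<eta> = d * L2_norm M u\<close>, the second alternative of the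
    dichotomy puts \<open>u\<close> within half the coercive distance \<open>c * L2_norm M u\<close>
    of every subspace, which only a vector of norm zero survives.\<close>
  define d where "d = c / (2 * n)"
  have d: "0 < d" "d < 1" "n * d = c / 2"
    using c n by (simp_all add: d_def field_simps)
  have d2: "d\<^sup>2 \<le> 1"
    using d by (simp add: power_le_one)
  show ?thesis
  proof (rule has_spectral_gapI)
    show "L2_linear M (L2_cycle M Fs)"
      using Fs by (rule L2_linear_cycle)
    show "L2_cycle M Fs (L2_class M (\<lambda>_. c)) = L2_class M (\<lambda>_. c)" for c
      using Fs const by (rule L2_cycle_fixes)
    show "0 \<le> sqrt (1 - d\<^sup>2)" "sqrt (1 - d\<^sup>2) < 1"
      using d d2 by simp_all
    fix u assume u: "u \<in> L2 M" "mean_op M u = L2_zero M"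
    note u0 = L2_norm_nonneg[OF u(1)]
    consider "(L2_norm M (L2_cycle M Fs u))\<^sup>2 \<le> (L2_norm M u)\<^sup>2 - (d * L2_norm M u)\<^sup>2"
      | "L2_norm M (L2_cycle M Fs u) \<le> L2_norm M u"
        "\<forall>F\<in>set Fs. \<exists>v\<in>F. L2_norm M (L2_diff M u v) \<le> n * (d * L2_norm M u)"
      using L2_cycle_dichotomy[OF Fs u(1), where \<eta> = "d * L2_norm M u"] d u0 unfolding n_def by auto
    then show "L2_norm M (L2_cycle M Fs u) \<le> sqrt (1 - d\<^sup>2) * L2_norm M u"
    proof cases
      case 1
      then have "(L2_norm M (L2_cycle M Fs u))\<^sup>2 \<le> (sqrt (1 - d\<^sup>2) * L2_norm M u)\<^sup>2"
        using d2 by (simp add: power_mult_distrib left_diff_distrib)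
      then show ?thesis
        by (rule power2_le_imp_le) (use d2 u0 in simp)
    next
      case 2
      obtain F where F: "F \<in> set Fs" "\<forall>v\<in>F. c * L2_norm M u \<le> L2_norm M (L2_diff M u v)"
        using far[OF u] by blast
      then have "c * L2_norm M u \<le> n * (d * L2_norm M u)"
        using 2 by (meson order_trans)
      also have "\<dots> = c / 2 * L2_norm M u"
        using d(3) by (simp add: mult.assoc[symmetric])
      finally have "L2_norm M u \<le> 0"
        using c by simp
      then show ?thesis
        using 2 u0 by simp
    qed
  qed
qed

end

section \<open>Mixtures of projections\<close>

definition L2_mixture ::
  "'b measure \<Rightarrow> 'i set \<Rightarrow> ('i \<Rightarrow> real) \<Rightarrow> ('i \<Rightarrow> ('b \<Rightarrow> complex) set set) \<Rightarrow> 'b L2_op" where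
  "L2_mixture M I w F u =
     L2_class M (\<lambda>x. \<Sum>i\<in>I. complex_of_real (w i) * L2_rep (L2_proj M (F i) u) x)"

lemma L2_linear_mixture:
  assumes "finite I" "\<And>i. i \<in> I \<Longrightarrow> L2_subspace M (F i)"
  shows "L2_linear M (L2_mixture M I w F)"
  unfolding L2_mixture_def using assms by (intro L2_linear_sum_op L2_linear_proj)

lemma L2_mixture_norm_le:
  assumes "finite I" "\<And>i. i \<in> I \<Longrightarrow> L2_subspace M (F i)" "\<And>i. i \<in> I \<Longrightarrow> 0 \<le> w i" "u \<in> L2 M"
  shows "L2_norm M (L2_mixture M I w F u) \<le> (\<Sum>i\<in>I. w i * L2_norm M (L2_proj M (F i) u))"
  using L2_norm_sum_le[of I "\<lambda>i. L2_proj M (F i) u" M "\<lambda>i. complex_of_real (w i)"] assms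
  by (simp add: L2_mixture_def L2_proj_in_L2)

lemma L2_mixture_fixes:
  assumes "\<And>i. i \<in> I \<Longrightarrow> L2_subspace M (F i)" "\<And>i. i \<in> I \<Longrightarrow> u \<in> F i" "u \<in> L2 M"
    and w: "sum w I = 1"
  shows "L2_mixture M I w F u = u"
proof -
  have "L2_mixture M I w F u = L2_class M (\<lambda>x. \<Sum>i\<in>I. complex_of_real (w i) * L2_rep u x)"
    using assms by (simp add: L2_mixture_def L2_proj_fixes cong: sum.cong)
  also have "\<dots> = L2_class M (L2_rep u)"
    by (simp add: sum_distrib_right[symmetric] of_real_sum[symmetric] w del: of_real_sum)
  finally show ?thesis
    using assms by (simp add: L2_class_rep)
qed

text \<open>As the weights add up to \<open>1\<close>, the displacement caused by the mixture is the
  same mixture of the individual displacements.\<close>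

lemma L2_diff_mixture:
  assumes I: "finite I" and F: "\<And>i. i \<in> I \<Longrightarrow> L2_subspace M (F i)" and u: "u \<in> L2 M"
    and w: "sum w I = 1"
  shows "L2_diff M u (L2_mixture M I w F u) =
    L2_class M (\<lambda>x. \<Sum>i\<in>I. complex_of_real (w i) * L2_rep (L2_diff M u (L2_proj M (F i) u)) x)"
proof -
  let ?p = "\<lambda>i. L2_rep (L2_proj M (F i) u)"
  have sq: "L2_rep u \<in> square_integrable M" "i \<in> I \<Longrightarrow> ?p i \<in> square_integrable M" for i
    using u F by (auto intro!: L2_rep_square_integrable L2_proj_in_L2)
  have "L2_class M (\<lambda>x. \<Sum>i\<in>I. complex_of_real (w i) * L2_rep (L2_diff M u (L2_proj M (F i) u)) x) =
      L2_class M (\<lambda>x. \<Sum>i\<in>I. complex_of_real (w i) * (L2_rep u x - ?p i x))"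
    unfolding L2_diff_def using I sq by (intro L2_class_sum_rep square_integrable_diff)
  also have "(\<lambda>x. \<Sum>i\<in>I. complex_of_real (w i) * (L2_rep u x - ?p i x)) =
      (\<lambda>x. L2_rep u x - (\<Sum>i\<in>I. complex_of_real (w i) * ?p i x))"
    by (simp add: right_diff_distrib sum_subtractf sum_distrib_right[symmetric]
        of_real_sum[symmetric] w del: of_real_sum)
  also have "L2_class M \<dots> = L2_diff M (L2_class M (L2_rep u)) (L2_mixture M I w F u)"
    unfolding L2_mixture_def using u F
    by (intro L2_diff_class[symmetric] sq square_integrable_sum_rep L2_proj_in_L2)
  finally show ?thesis
    using u by (simp add: L2_class_rep)
qed

context prob_space
begin

lemma L2_coercive_if_mixture_gap:
  assumes I: "finite I" and F: "\<And>i. i \<in> I \<Longrightarrow> L2_subspace M (F i)"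
    and w: "\<And>i. i \<in> I \<Longrightarrow> 0 \<le> w i" "sum w I = 1"
    and gap: "has_spectral_gap M (L2_mixture M I w F)"
  shows "L2_coercive M (F ` I)"
proof -
  obtain B where B: "B > 0" and lower:
    "\<And>u. u \<in> L2 M \<Longrightarrow> mean_op M u = L2_zero M \<Longrightarrow>
      L2_norm M u \<le> B * L2_norm M (L2_diff M u (L2_mixture M I w F u))"
    using has_spectral_gap_lower_bound[OF gap L2_linearD(1)[OF L2_linear_mixture[OF I F]]] by blast
  show ?thesis
  proof (rule L2_coerciveI[OF _ _ B])
    show "F ` I \<noteq> {}"
      using w by auto
    fix u e assume u: "u \<in> L2 M" "mean_op M u = L2_zero M"
      and near: "\<And>G. G \<in> F ` I \<Longrightarrow> \<exists>v\<in>G. L2_norm M (L2_diff M u v) \<le> e"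
    have close: "L2_norm M (L2_diff M u (L2_proj M (F i) u)) \<le> e" if "i \<in> I" for i
    proof -
      obtain v where "v \<in> F i" "L2_norm M (L2_diff M u v) \<le> e"
        using near \<open>i \<in> I\<close> by blast
      then show ?thesis
        using L2_proj_nearest[OF F[OF that] u(1)] by (meson order_trans)
    qed
    have "L2_norm M (L2_diff M u (L2_mixture M I w F u)) \<le>
        (\<Sum>i\<in>I. w i * L2_norm M (L2_diff M u (L2_proj M (F i) u)))"
      using L2_norm_sum_le[of I "\<lambda>i. L2_diff M u (L2_proj M (F i) u)" M "\<lambda>i. complex_of_real (w i)"]
        I F w u by (simp add: L2_diff_mixture L2_closed L2_proj_in_L2)
    also have "\<dots> \<le> (\<Sum>i\<in>I. w i * e)"
      using close w by (intro sum_mono mult_left_mono)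
    also have "\<dots> = e"
      by (simp add: sum_distrib_right[symmetric] w)
    finally have "B * L2_norm M (L2_diff M u (L2_mixture M I w F u)) \<le> B * e"
      using B by simp
    then show "L2_norm M u \<le> B * e"
      using lower[OF u] by simp
  qed (use F[unfolded L2_subspace_def] in blast)
qed

text \<open>Coercivity makes one projection, depending on \<open>u\<close>, shrink \<open>u\<close>
  by the factor \<open>s\<close>; the others do not enlarge it, so the convex combination shrinks it
  by \<open>1 - w i * (1 - s)\<close>.\<close>

lemma mixture_gap_if_L2_coercive:
  assumes I: "finite I" and F: "\<And>i. i \<in> I \<Longrightarrow> L2_subspace M (F i)"
    and const: "\<And>i c. i \<in> I \<Longrightarrow> L2_class M (\<lambda>_. c) \<in> F i"
    and w: "\<And>i. i \<in> I \<Longrightarrow> 0 < w i" "sum w I = 1"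
    and coercive: "L2_coercive M (F ` I)"
  shows "has_spectral_gap M (L2_mixture M I w F)"
proof -
  obtain c where c: "0 < c" "c \<le> 1" and far:
    "\<And>u. \<lbrakk>u \<in> L2 M; mean_op M u = L2_zero M\<rbrakk> \<Longrightarrow>
      \<exists>G\<in>F ` I. \<forall>v\<in>G. c * L2_norm M u \<le> L2_norm M (L2_diff M u v)"
    using L2_coercive_le_1[OF coercive] by blast
  have I_ne: "I \<noteq> {}"
    using w by auto
  define s where "s = sqrt (1 - c\<^sup>2)"
  have c2: "c\<^sup>2 \<le> 1"
    using c by (simp add: power_le_one)
  have s: "0 \<le> s" "s < 1" "s\<^sup>2 = 1 - c\<^sup>2"
    using c c2 by (simp_all add: s_def)
  \<comment> \<open>The contracting index varies with \<open>u\<close>; the smallest of the finitely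
    many positive weights makes the factor uniform.\<close>
  define m where "m = Min (w ` I)"
  have m_le: "m \<le> w i" if "i \<in> I" for i
    using I that by (simp add: m_def)
  have "m \<in> w ` I"
    unfolding m_def using I I_ne by (intro Min_in) auto
  then obtain j where j: "j \<in> I" "m = w j"
    by auto
  have "w j \<le> sum w I"
    using I j w by (intro member_le_sum) (auto intro: less_imp_le)
  then have m: "0 < m" "m \<le> 1"
    using w j by auto
  have ms: "0 \<le> m * (1 - s)" "m * (1 - s) \<le> 1" "0 < m * (1 - s)"
    using m s by (auto intro!: mult_le_one)
  show ?thesis
  proof (rule has_spectral_gapI)
    show "L2_linear M (L2_mixture M I w F)"
      using I F by (rule L2_linear_mixture)
    show "L2_mixture M I w F (L2_class M (\<lambda>_. c)) = L2_class M (\<lambda>_. c)" for c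
      using F const L2_class_in_L2[OF square_integrable_const] w(2) by (rule L2_mixture_fixes)
    show "0 \<le> 1 - m * (1 - s)" "1 - m * (1 - s) < 1"
      using ms by simp_all
    fix u assume u: "u \<in> L2 M" "mean_op M u = L2_zero M"
    note u0 = L2_norm_nonneg[OF u(1)]
    obtain i where i: "i \<in> I" and "\<forall>v\<in>F i. c * L2_norm M u \<le> L2_norm M (L2_diff M u v)"
      using far[OF u] by blast
    then have "c * L2_norm M u \<le> L2_norm M (L2_diff M u (L2_proj M (F i) u))"
      using L2_proj_in[OF F[OF i] u(1)] by blast
    then have "(c * L2_norm M u)\<^sup>2 \<le> (L2_norm M (L2_diff M u (L2_proj M (F i) u)))\<^sup>2"
      using c u0 by (intro power_mono) auto
    then have "(L2_norm M (L2_proj M (F i) u))\<^sup>2 \<le> (s * L2_norm M u)\<^sup>2"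
      using L2_proj_Pythagoras[OF F[OF i] u(1)]
      by (simp add: power_mult_distrib s left_diff_distrib)
    then have Pi: "L2_norm M (L2_proj M (F i) u) \<le> s * L2_norm M u"
      by (rule power2_le_imp_le) (use s u0 in simp)
    have "L2_norm M (L2_mixture M I w F u) \<le> (\<Sum>k\<in>I. w k * L2_norm M (L2_proj M (F k) u))"
      using w u by (intro L2_mixture_norm_le I F) (auto intro: less_imp_le)
    also have "\<dots> = w i * L2_norm M (L2_proj M (F i) u) +
        (\<Sum>k\<in>I - {i}. w k * L2_norm M (L2_proj M (F k) u))"
      using I i by (rule sum.remove)
    also have "\<dots> \<le> w i * (s * L2_norm M u) + (\<Sum>k\<in>I - {i}. w k * L2_norm M u)"
      using w i Pi u F by (intro add_mono mult_left_mono sum_mono L2_proj_norm_le)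
        (auto intro: less_imp_le)
    also have "\<dots> = (1 - w i * (1 - s)) * L2_norm M u"
    proof -
      have "sum w (I - {i}) = 1 - w i"
        using sum.remove[OF I i, of w] w(2) by simp
      then have "(\<Sum>k\<in>I - {i}. w k * L2_norm M u) = (1 - w i) * L2_norm M u"
        by (simp only: sum_distrib_right[symmetric])
      then show ?thesis
        by (simp add: algebra_simps)
    qed
    also have "\<dots> \<le> (1 - m * (1 - s)) * L2_norm M u"
      using m_le[OF i] s u0 by (intro mult_right_mono diff_left_mono) auto
    finally show "L2_norm M (L2_mixture M I w F u) \<le> (1 - m * (1 - s)) * L2_norm M u" .
  qed
qed

end

section \<open>Gibbs samplers and marginals\<close>

lemma const_coords_memI:
  assumes "f \<in> square_integrable M"
    and "\<And>x y. \<lbrakk>x \<in> space M; y \<in> space M; \<forall>k\<in>A - J. x k = y k\<rbrakk> \<Longrightarrow> f x = f y"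
  shows "L2_class M f \<in> const_coords A M J"
  using assms unfolding const_coords_def by (blast intro: L2_class_in_L2 L2_class_self)

lemma const_coords_cases:
  assumes "u \<in> const_coords A M J"
  obtains f where "f \<in> square_integrable M" "u = L2_class M f"
    "\<forall>x\<in>space M. \<forall>y\<in>space M. (\<forall>k\<in>A - J. x k = y k) \<longrightarrow> f x = f y"
proof -
  obtain f where u: "u \<in> L2 M" "f \<in> u"
    and f: "\<forall>x\<in>space M. \<forall>y\<in>space M. (\<forall>k\<in>A - J. x k = y k) \<longrightarrow> f x = f y"
    using assms by (auto simp: const_coords_def)
  show thesis
    by (rule that[of f]) (use L2_class_member[OF u] f in blast)+
qed

lemma const_mem_const_coords:
  assumes "finite_measure M"
  shows "L2_class M (\<lambda>_. c) \<in> const_coords A M J"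
  by (rule const_coords_memI) (simp_all add: finite_measure.square_integrable_const[OF assms])

text \<open>Completeness is the substance: the relation \<open>R\<close> of
  \<open>mcomplete_L2_respecting\<close> becomes agreement of two points of the space in the
  coordinates of \<open>A - J\<close>.\<close>

lemma L2_subspace_const_coords:
  assumes "finite_measure M"
  shows "L2_subspace M (const_coords A M J)"
  unfolding L2_subspace_def
proof (intro conjI ballI allI)
  interpret finite_measure M
    by fact
  show "const_coords A M J \<subseteq> L2 M"
    by (auto simp: const_coords_def)
  show "const_coords A M J \<noteq> {}"
    using const_mem_const_coords[OF assms] by blast
  show "Metric_space.mcomplete (const_coords A M J) (L2_dist M)"
    using mcomplete_L2_respecting[of "\<lambda>x y. x \<in> space M \<and> y \<in> space M \<and> (\<forall>k\<in>A - J. x k = y k)"]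
    unfolding const_coords_def Ball_def by (simp add: imp_conjL)
  fix u v c assume u: "u \<in> const_coords A M J"
  then obtain f where f: "f \<in> square_integrable M" "u = L2_class M f"
    "\<forall>x\<in>space M. \<forall>y\<in>space M. (\<forall>k\<in>A - J. x k = y k) \<longrightarrow> f x = f y"
    by (rule const_coords_cases)
  have "L2_class M (\<lambda>x. c * f x) \<in> const_coords A M J"
    using f(1) by (rule const_coords_memI[OF square_integrable_scale]) (metis f(3))
  then show "L2_scale M c u \<in> const_coords A M J"
    by (simp add: f L2_scale_class)
  assume "v \<in> const_coords A M J"
  then obtain g where g: "g \<in> square_integrable M" "v = L2_class M g"
    "\<forall>x\<in>space M. \<forall>y\<in>space M. (\<forall>k\<in>A - J. x k = y k) \<longrightarrow> g x = g y"
    by (rule const_coords_cases)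
  have "L2_class M (\<lambda>x. f x + g x) \<in> const_coords A M J"
    using f(1) g(1) by (rule const_coords_memI[OF square_integrable_add]) (metis f(3) g(3))
  then show "L2_add M u v \<in> const_coords A M J"
    by (simp add: f g L2_add_class)
qed

lemma const_coords_antimono: "J \<subseteq> J' \<Longrightarrow> const_coords A M J' \<subseteq> const_coords A M J"
  unfolding const_coords_def by blast

lemma gibbs_cycle_eq: "gibbs_cycle A M g J = L2_cycle M (map (\<lambda>d. const_coords A M (J d)) [1..<Suc g])"
  by (simp add: gibbs_cycle_def L2_cycle_def gibbs_step_def comp_def del: upt_Suc)

lemma gibbs_mixture_eq: "gibbs_mixture A M g w J = L2_mixture M {1..g} w (\<lambda>d. const_coords A M (J d))"
  by (simp add: fun_eq_iff gibbs_mixture_def L2_mixture_def gibbs_step_def)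

text \<open>Stated for arbitrary \<open>J\<close>, so that single coordinates in permuted order are
  covered as well.\<close>

lemma L2_coercive_if_gibbs_gap:
  assumes M: "prob_space M" and "g \<ge> 1"
    and gap: "has_spectral_gap M (gibbs_cycle A M g J) \<or>
      (\<exists>w. mixture_weights g w \<and> has_spectral_gap M (gibbs_mixture A M g w J))"
  shows "L2_coercive M ((\<lambda>d. const_coords A M (J d)) ` {1..g})"
proof -
  interpret prob_space M
    by fact
  have sub: "L2_subspace M (const_coords A M (J d))" for d
    by (rule L2_subspace_const_coords) unfold_locales
  have set: "set (map (\<lambda>d. const_coords A M (J d)) [1..<Suc g]) = (\<lambda>d. const_coords A M (J d)) ` {1..g}"
    by (simp add: atLeastLessThanSuc_atLeastAtMost del: upt_Suc)
  from gap show ?thesis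
  proof (elim disjE exE conjE)
    assume "has_spectral_gap M (gibbs_cycle A M g J)"
    then show ?thesis
      unfolding gibbs_cycle_eq set[symmetric]
      by (intro L2_coercive_if_cycle_gap) (use sub \<open>g \<ge> 1\<close> in auto)
  next
    fix w assume "mixture_weights g w" "has_spectral_gap M (gibbs_mixture A M g w J)"
    then show ?thesis
      unfolding gibbs_mixture_eq
      by (intro L2_coercive_if_mixture_gap)
        (auto simp: mixture_weights_def sub intro: less_imp_le)
  qed
qed

text \<open>The covering condition assigns to each coordinate a block whose space sits inside that
  of the coordinate; overlapping blocks do no harm.\<close>

lemma gibbs_gap_if_L2_coercive:
  assumes M: "prob_space M" and cover: "block_cover A g J"
    and coercive: "L2_coercive M ((\<lambda>i. const_coords A M {i}) ` A)"
  shows "has_spectral_gap M (gibbs_cycle A M g J)"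
    and "mixture_weights g w \<Longrightarrow> has_spectral_gap M (gibbs_mixture A M g w J)"
proof -
  interpret prob_space M
    by fact
  have sub: "L2_subspace M (const_coords A M (J d))" for d
    by (rule L2_subspace_const_coords) unfold_locales
  have set: "set (map (\<lambda>d. const_coords A M (J d)) [1..<Suc g]) = (\<lambda>d. const_coords A M (J d)) ` {1..g}"
    by (simp add: atLeastLessThanSuc_atLeastAtMost del: upt_Suc)
  have const: "L2_class M (\<lambda>_. c) \<in> const_coords A M (J d)" for c d
    by (rule const_mem_const_coords) unfold_locales
  have blocks: "L2_coercive M ((\<lambda>d. const_coords A M (J d)) ` {1..g})"
    using coercive
  proof (rule L2_coercive_mono)
    fix F assume "F \<in> (\<lambda>i. const_coords A M {i}) ` A"
    then obtain i where "i \<in> A" and F: "F = const_coords A M {i}"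
      by blast
    then obtain d where "d \<in> {1..g}" "i \<in> J d"
      using cover by (auto simp: block_cover_def)
    then show "\<exists>G\<in>(\<lambda>d. const_coords A M (J d)) ` {1..g}. G \<subseteq> F"
      unfolding F by (intro bexI[of _ "const_coords A M (J d)"] const_coords_antimono imageI) auto
  qed
  show "has_spectral_gap M (gibbs_cycle A M g J)"
    unfolding gibbs_cycle_eq
  proof (rule cycle_gap_if_L2_coercive)
    show "L2_coercive M (set (map (\<lambda>d. const_coords A M (J d)) [1..<Suc g]))"
      unfolding set by (rule blocks)
  qed (use sub const in auto)
  show "has_spectral_gap M (gibbs_mixture A M g w J)" if "mixture_weights g w"
    unfolding gibbs_mixture_eq using that
    by (intro mixture_gap_if_L2_coercive sub const blocks)
      (auto simp: mixture_weights_def)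
qed

section \<open>Borel structure and restriction of coordinates\<close>

lemma space_borel_of: "space (borel_of T) = topspace T"
  unfolding borel_of_def by (rule space_measure_of) (auto dest: openin_subset)

lemma measurable_borel_of_continuous_map:
  assumes "continuous_map S T f"
  shows "f \<in> borel_of S \<rightarrow>\<^sub>M borel_of T"
  unfolding borel_of_def[of T]
proof (rule measurable_measure_of)
  show "{U. openin T U} \<subseteq> Pow (topspace T)"
    by (auto dest: openin_subset)
  show "f \<in> space (borel_of S) \<rightarrow> topspace T"
    using assms by (simp add: space_borel_of continuous_map_def)
  fix U assume "U \<in> {U. openin T U}"
  then have "openin S {x \<in> topspace S. f x \<in> U}"
    using assms by (simp add: continuous_map_def)
  moreover have "f -` U \<inter> space (borel_of S) = {x \<in> topspace S. f x \<in> U}"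
    by (auto simp: space_borel_of)
  ultimately show "f -` U \<inter> space (borel_of S) \<in> sets (borel_of S)"
    by (auto simp: borel_of_def dest: openin_subset intro!: sigma_sets.Basic)
qed

text \<open>Restriction is continuous for the product topologies, hence Borel; this makes the
  marginal of a probability measure a probability measure.\<close>

lemma measurable_restrict_prod_borel:
  assumes "I \<subseteq> A"
  shows "(\<lambda>x. restrict x I) \<in> prod_borel X A \<rightarrow>\<^sub>M prod_borel X I"
  unfolding prod_borel_def
  by (intro measurable_borel_of_continuous_map continuous_on_restrict assms)

section \<open>Image measures\<close>

context
  fixes M :: "'b measure" and N :: "'c measure" and r :: "'b \<Rightarrow> 'c"
  assumes r [measurable]: "r \<in> M \<rightarrow>\<^sub>M N"
begin

lemma square_integrable_distr:
  assumes "f \<in> square_integrable (distr M N r)"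
  shows "(\<lambda>x. f (r x)) \<in> square_integrable M"
proof -
  have [measurable]: "f \<in> borel_measurable N"
    using square_integrable_measurable[OF assms] by simp
  show ?thesis
    using square_integrable_integrable[OF assms]
    by (simp add: square_integrable_def integrable_distr_eq)
qed

lemma L2_norm_distr:
  assumes f: "f \<in> square_integrable (distr M N r)"
  shows "L2_norm (distr M N r) (L2_class (distr M N r) f) = L2_norm M (L2_class M (\<lambda>x. f (r x)))"
proof -
  have [measurable]: "f \<in> borel_measurable N"
    using square_integrable_measurable[OF f] by simp
  show ?thesis
    by (simp add: L2_norm_class f square_integrable_distr integral_distr)
qed

text \<open>Composition with \<open>r\<close> is isometric. If the subspace \<open>F\<close> chosen
  for a lifted vector contains all lifted functions, that vector has norm zero. Otherwise
  \<open>F\<close> contains the lift of every member of some \<open>G\<close>, and distances to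
  members of \<open>G\<close> are distances to points of \<open>F\<close>.\<close>

lemma L2_coercive_distr:
  assumes M: "prob_space M" and coercive: "L2_coercive M \<F>"
    and \<G>: "\<G> \<noteq> {}" "\<And>G. G \<in> \<G> \<Longrightarrow> G \<subseteq> L2 (distr M N r)"
    and pull: "\<And>F. F \<in> \<F> \<Longrightarrow>
      (\<forall>f\<in>square_integrable (distr M N r). L2_class M (\<lambda>x. f (r x)) \<in> F) \<or>
      (\<exists>G\<in>\<G>. \<forall>v\<in>G. \<exists>f\<in>square_integrable (distr M N r).
        v = L2_class (distr M N r) f \<and> L2_class M (\<lambda>x. f (r x)) \<in> F)"
  shows "L2_coercive (distr M N r) \<G>"
proof -
  let ?D = "distr M N r"
  interpret M: prob_space M
    by fact
  interpret D: prob_space ?D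
    using r by (rule M.prob_space_distr)
  obtain c where c: "c > 0" and far: "\<And>u. \<lbrakk>u \<in> L2 M; mean_op M u = L2_zero M\<rbrakk> \<Longrightarrow>
      \<exists>F\<in>\<F>. \<forall>v\<in>F. c * L2_norm M u \<le> L2_norm M (L2_diff M u v)"
    using coercive unfolding L2_coercive_def by blast
  have "\<exists>G\<in>\<G>. \<forall>v\<in>G. c * L2_norm ?D u \<le> L2_norm ?D (L2_diff ?D u v)"
    if u: "u \<in> L2 ?D" "mean_op ?D u = L2_zero ?D" for u
  proof -
    obtain f where f: "f \<in> square_integrable ?D" and u_eq: "u = L2_class ?D f"
      using u(1) by (rule L2_cases)
    have [measurable]: "f \<in> borel_measurable N"
      using square_integrable_measurable[OF f] by simp
    let ?u = "L2_class M (\<lambda>x. f (r x))"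
    note fr = square_integrable_distr[OF f]
    have "L2_class ?D (\<lambda>_. \<integral>x. f x \<partial>?D) = L2_class ?D (\<lambda>_. 0)"
      using u f by (simp add: u_eq mean_op_class L2_zero_def)
    \<comment> \<open>Equality of classes says only that the constant vanishes almost everywhere;
      under a probability measure it is then zero.\<close>
    then have "AE x in ?D. (\<integral>x. f x \<partial>?D) = 0"
      by (rule L2_class_eqD[OF D.square_integrable_const])
    then have "(\<integral>x. f (r x) \<partial>M) = 0"
      by (simp add: D.AE_const integral_distr)
    then have "mean_op M ?u = L2_zero M"
      by (simp add: mean_op_class fr L2_zero_def)
    then obtain F where F: "F \<in> \<F>" and F_far: "\<And>v. v \<in> F \<Longrightarrow> c * L2_norm M ?u \<le> L2_norm M (L2_diff M ?u v)"
      using far[OF L2_class_in_L2[OF fr]] by blast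
    from pull[OF F] show ?thesis
    proof (elim disjE bexE)
      assume "\<forall>f\<in>square_integrable ?D. L2_class M (\<lambda>x. f (r x)) \<in> F"
      \<comment> \<open>The lifted vector itself is a point of \<open>F\<close>, at distance zero;
        afterwards any member of \<open>\<G>\<close> serves.\<close>
      then have "c * L2_norm M ?u \<le> 0"
        using F_far[of ?u] f by (simp add: L2_norm_diff_self L2_class_in_L2 fr)
      then have "c * L2_norm ?D u \<le> 0"
        by (simp add: u_eq L2_norm_distr f)
      moreover have "0 \<le> L2_norm ?D (L2_diff ?D u v)" if "G \<in> \<G>" "v \<in> G" for G v
        using \<G>(2) that u by (blast intro: L2_norm_nonneg L2_closed)
      ultimately show ?thesis
        using \<G>(1) by (meson all_not_in_conv order_trans)
    next
      fix G assume G: "G \<in> \<G>" "\<forall>v\<in>G. \<exists>f\<in>square_integrable ?D.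
        v = L2_class ?D f \<and> L2_class M (\<lambda>x. f (r x)) \<in> F"
      have "c * L2_norm ?D u \<le> L2_norm ?D (L2_diff ?D u v)" if "v \<in> G" for v
      proof -
        obtain h where h: "h \<in> square_integrable ?D" "v = L2_class ?D h" "L2_class M (\<lambda>x. h (r x)) \<in> F"
          using G \<open>v \<in> G\<close> by blast
        have "c * L2_norm ?D u \<le> L2_norm M (L2_diff M ?u (L2_class M (\<lambda>x. h (r x))))"
          using F_far[OF h(3)] by (simp add: u_eq L2_norm_distr f)
        also have "\<dots> = L2_norm ?D (L2_diff ?D u v)"
          by (simp add: u_eq h L2_diff_class fr f square_integrable_distr[OF h(1)]
              L2_norm_distr square_integrable_diff)
        finally show ?thesis .
      qed
      with G show ?thesis
        by blast
    qed
  qed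
  with c show ?thesis
    unfolding L2_coercive_def by blast
qed

end

text \<open>A discarded coordinate falls under the first alternative of
  \<open>L2_coercive_distr\<close>, a retained one under the second, with the space of the same
  coordinate.\<close>

lemma L2_coercive_marginal:
  fixes X :: "nat \<Rightarrow> 'a metric"
  assumes \<pi>: "prob_space \<pi>" "sets \<pi> = sets (prod_borel X A)" and I: "I \<subseteq> A" "I \<noteq> {}"
    and coercive: "L2_coercive \<pi> ((\<lambda>i. const_coords A \<pi> {i}) ` A)"
  shows "L2_coercive (marginal X \<pi> I) ((\<lambda>i. const_coords I (marginal X \<pi> I) {i}) ` I)"
proof -
  let ?r = "\<lambda>x. restrict x I"
  have r: "?r \<in> \<pi> \<rightarrow>\<^sub>M prod_borel X I"
    using measurable_restrict_prod_borel[OF I(1), of X] by (simp add: measurable_cong_sets[OF \<pi>(2) refl])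
  let ?D = "distr \<pi> (prod_borel X I) ?r"
  note D = square_integrable_distr[OF r]
  have space: "?r x \<in> space ?D" if "x \<in> space \<pi>" for x
    using measurable_space[OF r that] by simp
  show ?thesis
    unfolding marginal_def
  proof (rule L2_coercive_distr[OF r \<pi>(1) coercive])
    show "(\<lambda>i. const_coords I ?D {i}) ` I \<noteq> {}"
      using I by simp
    show "G \<subseteq> L2 ?D" if "G \<in> (\<lambda>i. const_coords I ?D {i}) ` I" for G
      using that by (auto simp: const_coords_def)
    fix F assume "F \<in> (\<lambda>i. const_coords A \<pi> {i}) ` A"
    then obtain i where i: "i \<in> A" "F = const_coords A \<pi> {i}"
      by blast
    show "(\<forall>f\<in>square_integrable ?D. L2_class \<pi> (\<lambda>x. f (?r x)) \<in> F) \<or>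
      (\<exists>G\<in>(\<lambda>i. const_coords I ?D {i}) ` I. \<forall>v\<in>G. \<exists>f\<in>square_integrable ?D.
        v = L2_class ?D f \<and> L2_class \<pi> (\<lambda>x. f (?r x)) \<in> F)"
    proof (cases "i \<in> I")
      case False
      have "L2_class \<pi> (\<lambda>x. f (?r x)) \<in> F" if "f \<in> square_integrable ?D" for f
        unfolding i
      proof (rule const_coords_memI[OF D[OF that]])
        fix x y :: "nat \<Rightarrow> 'a" assume "\<forall>k\<in>A - {i}. x k = y k"
        \<comment> \<open>As \<open>i \<notin> I\<close>, agreement off \<open>i\<close> includes
          agreement on all of \<open>I\<close>.\<close>
        then have "?r x = ?r y"
          using False I by (intro restrict_ext) auto
        then show "f (?r x) = f (?r y)"
          by simp
      qed
      then show ?thesis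
        by blast
    next
      case True
      have "\<exists>f\<in>square_integrable ?D. v = L2_class ?D f \<and> L2_class \<pi> (\<lambda>x. f (?r x)) \<in> F"
        if "v \<in> const_coords I ?D {i}" for v
      proof -
        obtain f where f: "f \<in> square_integrable ?D" "v = L2_class ?D f" and
          const: "\<forall>x\<in>space ?D. \<forall>y\<in>space ?D. (\<forall>k\<in>I - {i}. x k = y k) \<longrightarrow> f x = f y"
          using \<open>v \<in> const_coords I ?D {i}\<close> by (rule const_coords_cases)
        have "L2_class \<pi> (\<lambda>x. f (?r x)) \<in> F"
          unfolding i
        proof (rule const_coords_memI[OF D[OF f(1)]])
          fix x y assume "x \<in> space \<pi>" "y \<in> space \<pi>" "\<forall>k\<in>A - {i}. x k = y k"
          \<comment> \<open>The restrictions lie in the space of the marginal and agree on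
            \<open>I - {i}\<close>, a subset of \<open>A - {i}\<close>.\<close>
          then show "f (?r x) = f (?r y)"
            using I by (intro const[rule_format] space) auto
        qed
        with f show ?thesis
          by blast
      qed
      then show ?thesis
        using True by blast
    qed
  qed
qed

section \<open>From one full sampler to all cycles, mixtures and marginals\<close>

theorem theorem1p1:
  fixes K :: nat and X :: "nat \<Rightarrow> 'a metric" and \<pi> :: "(nat \<Rightarrow> 'a) measure"
  assumes "K \<ge> 2"
    and "\<And>k. k \<in> {1..K} \<Longrightarrow> mcomplete_of (X k)"
    and "\<And>k. k \<in> {1..K} \<Longrightarrow> separable_space (mtopology_of (X k))"
    and "sets \<pi> = sets (prod_borel X {1..K})"
    and "prob_space \<pi>"
    and "(\<exists>\<rho>. \<rho> permutes {1..K} \<and>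
              has_spectral_gap \<pi> (gibbs_cycle {1..K} \<pi> K (\<lambda>i. {\<rho> i}))) \<or>
         (\<exists>w. mixture_weights K w \<and>
              has_spectral_gap \<pi> (gibbs_mixture {1..K} \<pi> K w (\<lambda>i. {i})))"
  shows "(\<forall>g J. block_cover {1..K} g J \<longrightarrow>
            has_spectral_gap \<pi> (gibbs_cycle {1..K} \<pi> g J) \<and>
            (\<forall>w. mixture_weights g w \<longrightarrow>
               has_spectral_gap \<pi> (gibbs_mixture {1..K} \<pi> g w J))) \<and>
         (K \<ge> 3 \<longrightarrow>
           (\<forall>I. I \<subset> {1..K} \<and> card I \<ge> 2 \<longrightarrow>
             (\<forall>g J. block_cover I g J \<longrightarrow>
                has_spectral_gap (marginal X \<pi> I) (gibbs_cycle I (marginal X \<pi> I) g J) \<and>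
                (\<forall>w. mixture_weights g w \<longrightarrow>
                   has_spectral_gap (marginal X \<pi> I)
                     (gibbs_mixture I (marginal X \<pi> I) g w J)))))"
proof -
  interpret prob_space \<pi>
    by fact
  let ?\<F> = "(\<lambda>i. const_coords {1..K} \<pi> {i}) ` {1..K}"
  have K: "1 \<le> K"
    using assms(1) by simp
  have coercive: "L2_coercive \<pi> ?\<F>"
    using assms(6)
  proof (elim disjE exE conjE)
    fix \<rho> assume \<rho>: "\<rho> permutes {1..K}"
      and gap: "has_spectral_gap \<pi> (gibbs_cycle {1..K} \<pi> K (\<lambda>i. {\<rho> i}))"
    \<comment> \<open>A permutation only reorders the coordinate spaces, and coercivity sees their
      set.\<close>
    have "(\<lambda>i. const_coords {1..K} \<pi> {\<rho> i}) ` {1..K} =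
        (\<lambda>i. const_coords {1..K} \<pi> {i}) ` (\<rho> ` {1..K})"
      by (simp add: image_image)
    also have "\<dots> = ?\<F>"
      by (simp only: permutes_image[OF \<rho>])
    finally show ?thesis
      using L2_coercive_if_gibbs_gap[OF assms(5) K disjI1[OF gap]] by simp
  next
    fix w assume "mixture_weights K w"
      "has_spectral_gap \<pi> (gibbs_mixture {1..K} \<pi> K w (\<lambda>i. {i}))"
    then show ?thesis
      by (intro L2_coercive_if_gibbs_gap[OF assms(5) K]) blast
  qed
  have full: "has_spectral_gap \<pi> (gibbs_cycle {1..K} \<pi> g J)"
    "mixture_weights g w \<Longrightarrow> has_spectral_gap \<pi> (gibbs_mixture {1..K} \<pi> g w J)"
    if "block_cover {1..K} g J" for g J w
    using gibbs_gap_if_L2_coercive[OF assms(5) that coercive] by blast+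
  have collapsed:
    "has_spectral_gap (marginal X \<pi> I) (gibbs_cycle I (marginal X \<pi> I) g J)"
    "mixture_weights g w \<Longrightarrow>
      has_spectral_gap (marginal X \<pi> I) (gibbs_mixture I (marginal X \<pi> I) g w J)"
    if I: "I \<subset> {1..K}" "card I \<ge> 2" and cover: "block_cover I g J" for I g J w
  proof -
    have I': "I \<subseteq> {1..K}" "I \<noteq> {}"
      using I by auto
    have "(\<lambda>x. restrict x I) \<in> \<pi> \<rightarrow>\<^sub>M prod_borel X I"
      using measurable_restrict_prod_borel[OF I'(1), of X]
      by (simp add: measurable_cong_sets[OF assms(4) refl])
    then have D: "prob_space (marginal X \<pi> I)"
      unfolding marginal_def by (rule prob_space_distr)
    note gap = gibbs_gap_if_L2_coercive[OF D cover
        L2_coercive_marginal[OF assms(5,4) I' coercive]]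
    show "has_spectral_gap (marginal X \<pi> I) (gibbs_cycle I (marginal X \<pi> I) g J)"
      by (rule gap)
    show "has_spectral_gap (marginal X \<pi> I) (gibbs_mixture I (marginal X \<pi> I) g w J)"
      if "mixture_weights g w"
      using that by (rule gap)
  qed
  show ?thesis
    using full collapsed by blast
qed

end
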